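(* Let $p>1$, $\gamma>0$ and $-1<\mu,\nu<p-1$. Let $\lambda$ be a positive Borel measure on $[0,1)$ such that $d\rho(t):=(1-t)^{\gamma-1}d\lambda(t)$ is a finite measure on $[0,1)$. For a sequence $a=\{a_n\}_{n=1}^{\infty}$ of complex numbers, define $$\widehat{\mathbf{H}}^{\mu,\nu}_{\gamma,\lambda}(a)(m):=\sum_{n=1}^{\infty}m^{\frac{\mu}{p}}n^{-\frac{\nu}{p}}\,\mathcal{I}_\lambda[m,n]\,a_n,\quad m\ge 1,\qquad \mathcal{I}_\lambda[m,n]=\int_{[0,1)}t^{\max\{m,n\}-1}(1-t)^{\gamma-1}d\lambda(t),\quad m,n\ge1.$$ Then $\widehat{\mathbf{H}}^{\mu,\nu}_{\gamma,\lambda}$ is compact on $l^p$ if and only if $\rho$ is a vanishing $[1+\frac1p(\mu-\nu)]$-Carleson measure on $[0,1)$.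
   Context: $l^p$ is the space of complex sequences $a=\{a_n\}_{n=1}^{\infty}$ with $\|a\|_p=\left(\sum_{n=1}^{\infty}|a_n|^p\right)^{1/p}<+\infty$. "Compact on $l^p$" means that the formula defines a (bounded, everywhere defined) compact linear operator $l^p\to l^p$. For $s>0$, a positive Borel measure $\rho$ on $[0,1)$ is an $s$-Carleson measure if there is a constant $C>0$ such that $\rho([t,1))\le C(1-t)^s$ for all $t\in[0,1)$; it is a vanishing $s$-Carleson measure if moreover $\lim_{t\to1^-}\frac{\rho([t,1))}{(1-t)^s}=0$. The convention $t^0=1$ for all $t\in[0,1)$ is used. *)

theory Defs
  imports "HOL-Analysis.Analysis"
begin

section \<open>The sequence space $l^p$\<close>

text \<open>Sequences $(a_n)_{n \ge 1}$ are functions on \<open>nat\<close> with \<open>a i\<close> standing for $a_{i+1}$.\<close>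

definition lp_space :: "real \<Rightarrow> (nat \<Rightarrow> complex) set" where
  "lp_space p = {a. summable (\<lambda>i. norm (a i) powr p)}"

definition lp_norm :: "real \<Rightarrow> (nat \<Rightarrow> complex) \<Rightarrow> real" where
  "lp_norm p a = (\<Sum>i. norm (a i) powr p) powr (1 / p)"

definition lp_dist :: "real \<Rightarrow> (nat \<Rightarrow> complex) \<Rightarrow> (nat \<Rightarrow> complex) \<Rightarrow> real" where
  "lp_dist p a b = lp_norm p (\<lambda>i. a i - b i)"

text \<open>Outside its locale, \<open>Metric_space.mtopology\<close> is meaningful only for an actual metric;
  this is \<open>Metric_space_lp\<close> below.\<close>

abbreviation lp_topology :: "real \<Rightarrow> (nat \<Rightarrow> complex) topology" where
  "lp_topology p \<equiv> Metric_space.mtopology (lp_space p) (lp_dist p)"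

lemma lp_norm_nonneg: "0 \<le> lp_norm p a"
  by (simp add: lp_norm_def)

lemma lp_norm_powr:
  assumes "p \<ge> 1" "a \<in> lp_space p"
  shows "lp_norm p a powr p = (\<Sum>i. norm (a i) powr p)"
proof -
  have "0 \<le> (\<Sum>i. norm (a i) powr p)"
    using assms by (intro suminf_nonneg) (auto simp: lp_space_def)
  then show ?thesis
    using assms by (simp add: lp_norm_def powr_powr)
qed

lemma lp_norm_eq_0:
  assumes "p \<ge> 1" "a \<in> lp_space p"
  shows "lp_norm p a = 0 \<longleftrightarrow> (\<forall>i. a i = 0)"
proof -
  have "lp_norm p a = 0 \<longleftrightarrow> (\<Sum>i. norm (a i) powr p) = 0"
    by (simp add: lp_norm_def)
  also have "\<dots> \<longleftrightarrow> (\<forall>i. norm (a i) powr p = 0)"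
    using assms by (intro suminf_eq_zero_iff) (auto simp: lp_space_def)
  finally show ?thesis by simp
qed

lemma powr_convex_combination:
  fixes x y u v p :: real
  assumes "p \<ge> 1" "0 \<le> x" "0 \<le> y" "0 < u" "0 < v" "u + v = 1"
  shows "(u * x + v * y) powr p \<le> u * x powr p + v * y powr p"
proof -
  have z: "(w * z) powr p \<le> w * z powr p" if "0 < w" "w \<le> 1" "0 \<le> z" for w z :: real
  proof -
    have "w powr p \<le> w"
      using powr_mono'[of 1 p w] that assms by simp
    then show ?thesis
      using that by (simp add: powr_mult mult_right_mono)
  qed
  show ?thesis
  proof (cases "x = 0 \<or> y = 0")
    case True
    then show ?thesis
      using z[of u x] z[of v y] assms by auto
  next
    case False
    then have "x > 0" "y > 0"
      using assms by auto
    then show ?thesis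
      using convex_onD[OF powr_convex[OF assms(1)], of v x y] assms
      by (simp add: eq_diff_eq[symmetric])
  qed
qed

lemma lp_add:
  assumes p: "p \<ge> 1" and a: "a \<in> lp_space p" and b: "b \<in> lp_space p"
  shows "(\<lambda>i. a i + b i) \<in> lp_space p"
    and "lp_norm p (\<lambda>i. a i + b i) \<le> lp_norm p a + lp_norm p b"
proof -
  define A where "A = lp_norm p a"
  define B where "B = lp_norm p b"
  have "(\<lambda>i. a i + b i) \<in> lp_space p \<and> lp_norm p (\<lambda>i. a i + b i) \<le> A + B"
  proof (cases "A = 0 \<or> B = 0")
    case True
    then have "(\<forall>i. a i = 0) \<or> (\<forall>i. b i = 0)"
      unfolding A_def B_def using lp_norm_eq_0 p a b by blast
    then show ?thesis
      using a b lp_norm_nonneg[of p a] lp_norm_nonneg[of p b] by (auto simp: A_def B_def)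
  next
    case False
    then have pos: "A > 0" "B > 0"
      using lp_norm_nonneg[of p a] lp_norm_nonneg[of p b] by (auto simp: A_def B_def)
    define u where "u = A / (A + B)"
    define v where "v = B / (A + B)"
    have uv: "u > 0" "v > 0" "u + v = 1"
      using pos by (auto simp: u_def v_def add_divide_distrib[symmetric])
    let ?g = "\<lambda>i. (A + B) powr p * (u * (norm (a i) powr p / A powr p)
                    + v * (norm (b i) powr p / B powr p))"
    have le: "norm (a i + b i) powr p \<le> ?g i" for i
    proof -
      have "norm (a i + b i) \<le> norm (a i) + norm (b i)"
        by (rule norm_triangle_ineq)
      also have "\<dots> = (A + B) * (u * (norm (a i) / A) + v * (norm (b i) / B))"
      proof -
        have "u * (norm (a i) / A) = norm (a i) / (A + B)" "v * (norm (b i) / B) = norm (b i) / (A + B)"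
          using pos by (auto simp: u_def v_def)
        then show ?thesis
          using pos by (simp add: add_divide_distrib[symmetric])
      qed
      finally have "norm (a i + b i) powr p
          \<le> ((A + B) * (u * (norm (a i) / A) + v * (norm (b i) / B))) powr p"
        using p by (intro powr_mono2) auto
      also have "\<dots> = (A + B) powr p * (u * (norm (a i) / A) + v * (norm (b i) / B)) powr p"
        by (rule powr_mult)
      also have "\<dots> \<le> (A + B) powr p *
          (u * (norm (a i) / A) powr p + v * (norm (b i) / B) powr p)"
        using pos uv p by (intro mult_left_mono powr_convex_combination) auto
      also have "\<dots> = ?g i"
        using pos by (simp add: powr_divide)
      finally show ?thesis .
    qed
    have sa: "(\<lambda>i. norm (a i) powr p) sums (A powr p)"
      using a lp_norm_powr[OF p a] by (simp add: A_def lp_space_def summable_sums)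
    have sb: "(\<lambda>i. norm (b i) powr p) sums (B powr p)"
      using b lp_norm_powr[OF p b] by (simp add: B_def lp_space_def summable_sums)
    have "?g sums ((A + B) powr p * (u * (A powr p / A powr p) + v * (B powr p / B powr p)))"
      by (intro sums_mult sums_add sums_divide sa sb)
    then have g: "?g sums ((A + B) powr p)"
      using pos uv by simp
    have S: "summable (\<lambda>i. norm (a i + b i) powr p)"
      by (rule summable_comparison_test'[OF sums_summable[OF g], of 0]) (use le in auto)
    have "(\<Sum>i. norm (a i + b i) powr p) \<le> (A + B) powr p"
      using suminf_le[OF le S sums_summable[OF g]] sums_unique[OF g] by simp
    moreover have "0 \<le> (\<Sum>i. norm (a i + b i) powr p)"
      using S by (intro suminf_nonneg) auto
    ultimately have "lp_norm p (\<lambda>i. a i + b i) \<le> ((A + B) powr p) powr (1 / p)"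
      unfolding lp_norm_def using p by (intro powr_mono2) auto
    then show ?thesis
      using S pos p by (simp add: lp_space_def powr_powr)
  qed
  then show "(\<lambda>i. a i + b i) \<in> lp_space p"
    and "lp_norm p (\<lambda>i. a i + b i) \<le> lp_norm p a + lp_norm p b"
    by (auto simp: A_def B_def)
qed

lemma lp_diff:
  assumes "p \<ge> 1" "a \<in> lp_space p" "b \<in> lp_space p"
  shows "(\<lambda>i. a i - b i) \<in> lp_space p"
  using lp_add(1)[of p a "\<lambda>i. - b i"] assms by (simp add: lp_space_def)

lemma Metric_space_lp:
  assumes p: "p \<ge> 1"
  shows "Metric_space (lp_space p) (lp_dist p)"
proof
  fix a b c
  show "0 \<le> lp_dist p a b"
    by (simp add: lp_dist_def lp_norm_nonneg)
  show "lp_dist p a b = lp_dist p b a"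
    by (simp add: lp_dist_def lp_norm_def norm_minus_commute)
  assume a: "a \<in> lp_space p" and b: "b \<in> lp_space p"
  show "lp_dist p a b = 0 \<longleftrightarrow> a = b"
    using lp_norm_eq_0[OF p lp_diff[OF p a b]] by (auto simp: lp_dist_def)
  assume c: "c \<in> lp_space p"
  show "lp_dist p a c \<le> lp_dist p a b + lp_dist p b c"
    using lp_add(2)[OF p lp_diff[OF p a b] lp_diff[OF p b c]] by (simp add: lp_dist_def)
qed

definition bounded_linear_on_lp :: "real \<Rightarrow> ((nat \<Rightarrow> complex) \<Rightarrow> nat \<Rightarrow> complex) \<Rightarrow> bool" where
  "bounded_linear_on_lp p T \<longleftrightarrow>
     T ` lp_space p \<subseteq> lp_space p \<and>
     (\<forall>a\<in>lp_space p. \<forall>b\<in>lp_space p. T (\<lambda>i. a i + b i) = (\<lambda>i. T a i + T b i)) \<and>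
     (\<forall>c. \<forall>a\<in>lp_space p. T (\<lambda>i. c * a i) = (\<lambda>i. c * T a i)) \<and>
     (\<exists>C. \<forall>a\<in>lp_space p. lp_norm p (T a) \<le> C * lp_norm p a)"

definition compact_on_lp :: "real \<Rightarrow> ((nat \<Rightarrow> complex) \<Rightarrow> nat \<Rightarrow> complex) \<Rightarrow> bool" where
  "compact_on_lp p T \<longleftrightarrow>
     bounded_linear_on_lp p T \<and>
     compactin (lp_topology p)
       (lp_topology p closure_of (T ` {a \<in> lp_space p. lp_norm p a \<le> 1}))"

section \<open>Carleson measures on $[0,1)$\<close>

definition borel_measure_01 :: "real measure \<Rightarrow> bool" where
  "borel_measure_01 M \<longleftrightarrow> sets M = sets (restrict_space borel {0..<1})"

definition carleson :: "real \<Rightarrow> real measure \<Rightarrow> bool" where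
  "carleson s \<rho> \<longleftrightarrow>
     (\<exists>C>0. \<forall>t\<in>{0..<1}. emeasure \<rho> {t..<1} \<le> ennreal (C * (1 - t) powr s))"

text \<open>The values \<open>\<rho> {t..<1}\<close> are finite by the first conjunct, so \<open>measure\<close> loses nothing.\<close>

definition vanishing_carleson :: "real \<Rightarrow> real measure \<Rightarrow> bool" where
  "vanishing_carleson s \<rho> \<longleftrightarrow>
     carleson s \<rho> \<and> ((\<lambda>t. measure \<rho> {t..<1} / (1 - t) powr s) \<longlongrightarrow> 0) (at_left 1)"

section \<open>The operator\<close>

definition weighted_measure :: "real \<Rightarrow> real measure \<Rightarrow> real measure" where
  "weighted_measure \<gamma> M = density M (\<lambda>t. ennreal ((1 - t) powr (\<gamma> - 1)))"

text \<open>The integral ranges over \<open>space M = {0..<1}\<close>; recall \<open>0 ^ 0 = 1\<close>.\<close>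

definition I_moment :: "real \<Rightarrow> real measure \<Rightarrow> nat \<Rightarrow> nat \<Rightarrow> real" where
  "I_moment \<gamma> M m n = (\<integral>t. t ^ (max m n - 1) * (1 - t) powr (\<gamma> - 1) \<partial>M)"

text \<open>The coefficient in row \<open>m\<close> and column \<open>n\<close>, where \<open>m, n \<ge> 1\<close>.\<close>

definition H_coeff ::
  "real \<Rightarrow> real \<Rightarrow> real \<Rightarrow> real \<Rightarrow> real measure \<Rightarrow> nat \<Rightarrow> nat \<Rightarrow> real" where
  "H_coeff p \<mu> \<nu> \<gamma> M m n =
     real m powr (\<mu> / p) * real n powr (- (\<nu> / p)) * I_moment \<gamma> M m n"

definition H_term ::
  "real \<Rightarrow> real \<Rightarrow> real \<Rightarrow> real \<Rightarrow> real measure \<Rightarrow> (nat \<Rightarrow> complex) \<Rightarrow> nat \<Rightarrow> nat \<Rightarrow> complex" where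
  "H_term p \<mu> \<nu> \<gamma> M a i j = of_real (H_coeff p \<mu> \<nu> \<gamma> M (Suc i) (Suc j)) * a j"

definition H_op ::
  "real \<Rightarrow> real \<Rightarrow> real \<Rightarrow> real \<Rightarrow> real measure \<Rightarrow> (nat \<Rightarrow> complex) \<Rightarrow> nat \<Rightarrow> complex" where
  "H_op p \<mu> \<nu> \<gamma> M a = (\<lambda>i. \<Sum>j. H_term p \<mu> \<nu> \<gamma> M a i j)"

text \<open>\<open>suminf\<close> is total, so the convergence of the defining series on all of $l^p$ is
  part of what it means that the formula defines a compact operator.\<close>

definition H_compact :: "real \<Rightarrow> real \<Rightarrow> real \<Rightarrow> real \<Rightarrow> real measure \<Rightarrow> bool" where
  "H_compact p \<mu> \<nu> \<gamma> M \<longleftrightarrow>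
     (\<forall>a\<in>lp_space p. \<forall>i. summable (H_term p \<mu> \<nu> \<gamma> M a i)) \<and>
     compact_on_lp p (H_op p \<mu> \<nu> \<gamma> M)"

end

theory Submission
  imports Defs "HOL-Real_Asymp.Real_Asymp"
begin

text \<open>
  Write $\alpha = \mu / p$, $\beta = \nu / p$, $s = 1 + \alpha - \beta$ and let $c_k$ be the $k$-th moment
  of $\rho$, so that the operator has the kernel $i^\alpha j^{-\beta} c_{\max(i,j) - 1}$. Since
  $t^k$ is comparable to $1$ on $[1 - 1/k, 1)$ and decays exponentially in $k (1 - t)$, the measure
  is vanishing $s$-Carleson iff $k^s c_k \to 0$. In that case the kernel is dominated by a kernel
  homogeneous of degree $-1$, bounded on $l^p$ by the Schur test with weights $j^{-1/p}$, and the
  part of it where $\max(i,j) \ge N$ has norm tending to $0$; hence a coordinatewise convergent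
  sequence in the unit ball is mapped to a norm convergent one. Conversely, the image of the
  unit ball under a compact operator has uniformly small tails, and the tail from $N$ on of the image
  of $N^{-1/p} 1_{[N, 2N)}$ has norm at least a constant times $N^s c_{2N}$.
\<close>

section \<open>Kernel operators and the Schur test\<close>

text \<open>The endpoint 0 has to belong to the domain, since Jensen's inequality is applied below
  to entries that may vanish.\<close>

lemma convex_on_powr_atLeast_0:
  fixes p :: real
  assumes "p \<ge> 1"
  shows "convex_on {0..} (\<lambda>x. x powr p)"
proof (rule convex_onI)
  fix t x y :: real
  assume "0 < t" "t < 1" "x \<in> {0..}" "y \<in> {0..}"
  then show "((1 - t) *\<^sub>R x + t *\<^sub>R y) powr p \<le> (1 - t) * x powr p + t * y powr p"
    using powr_convex_combination[OF assms, of x y "1 - t" t] by simp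
qed simp

text \<open>Jensen's inequality for \<open>x powr p\<close> with the weights \<open>w i / V\<close>,
  where \<open>V\<close> is their sum. Undoing the normalisation leaves the factor
  \<open>V powr (p - 1)\<close>, which increases with \<open>V\<close>, so an upper bound
  \<open>W\<close> suffices.\<close>

lemma sum_weighted_powr_le:
  fixes w x :: "'i \<Rightarrow> real"
  assumes p: "p \<ge> 1" and fin: "finite S"
    and w: "\<And>i. i \<in> S \<Longrightarrow> 0 \<le> w i" and x: "\<And>i. i \<in> S \<Longrightarrow> 0 \<le> x i"
    and W: "sum w S \<le> W"
  shows "(\<Sum>i\<in>S. w i * x i) powr p \<le> W powr (p - 1) * (\<Sum>i\<in>S. w i * x i powr p)"
proof (cases "sum w S = 0")
  case True
  then have "w i = 0" if "i \<in> S" for i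
    using w fin that by (simp add: sum_nonneg_eq_0_iff)
  then show ?thesis by simp
next
  case False
  define V where "V = sum w S"
  have V: "V > 0"
    using False w by (simp add: V_def less_le sum_nonneg)
  have "S \<noteq> {}"
    using False by auto
  then have "(\<Sum>i\<in>S. (w i / V) *\<^sub>R x i) powr p \<le> (\<Sum>i\<in>S. (w i / V) * x i powr p)"
    using V fin w x
    by (intro convex_on_sum[OF _ _ convex_on_powr_atLeast_0[OF p]])
      (auto simp: V_def sum_divide_distrib[symmetric])
  then have "((\<Sum>i\<in>S. w i * x i) / V) powr p \<le> (\<Sum>i\<in>S. w i * x i powr p) / V"
    by (simp add: sum_divide_distrib)
  then have "(\<Sum>i\<in>S. w i * x i) powr p \<le> V powr p * ((\<Sum>i\<in>S. w i * x i powr p) / V)"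
    using V by (simp add: powr_divide pos_divide_le_eq mult.commute)
  also have "\<dots> = V powr (p - 1) * (\<Sum>i\<in>S. w i * x i powr p)"
    using V by (simp add: powr_diff)
  also have "\<dots> \<le> W powr (p - 1) * (\<Sum>i\<in>S. w i * x i powr p)"
    using V W p w x by (intro mult_right_mono powr_mono2 sum_nonneg mult_nonneg_nonneg) (auto simp: V_def)
  finally show ?thesis .
qed

text \<open>Jensen's inequality with the weights \<open>K i j * u j\<close> replaces Hoelder's.\<close>

lemma schur_test_finite:
  fixes K :: "nat \<Rightarrow> nat \<Rightarrow> real"
  assumes p: "p > 1" and C: "C \<ge> 0"
    and K: "\<And>i j. 0 \<le> K i j" and u: "\<And>i. 0 < u i"
    and rows: "\<And>i n. (\<Sum>j<n. K i j * u j) \<le> C * u i"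
    and cols: "\<And>j n. (\<Sum>i<n. K i j * u i powr (p - 1)) \<le> C * u j powr (p - 1)"
    and b: "\<And>j. 0 \<le> b j"
  shows "(\<Sum>i<m. (\<Sum>j<n. K i j * b j) powr p) \<le> C powr p * (\<Sum>j<n. b j powr p)"
proof -
  \<comment> \<open>Splitting \<open>b j\<close> as \<open>u j * (b j / u j)\<close> makes
    \<open>K i j * u j\<close> the weights, whose sum over \<open>j\<close> the row hypothesis
    controls.\<close>
  have row: "(\<Sum>j<n. K i j * b j) powr p
      \<le> (C * u i) powr (p - 1) * (\<Sum>j<n. K i j * u j * (b j / u j) powr p)" for i
  proof -
    have "(\<Sum>j<n. K i j * u j * (b j / u j)) powr p
        \<le> (C * u i) powr (p - 1) * (\<Sum>j<n. K i j * u j * (b j / u j) powr p)"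
      using p K u b rows by (intro sum_weighted_powr_le) (auto intro!: mult_nonneg_nonneg divide_nonneg_pos intro: less_imp_le)
    moreover have "K i j * u j * (b j / u j) = K i j * b j" for j
      using u[of j] by simp
    ultimately show ?thesis by simp
  qed
  have "(\<Sum>i<m. (\<Sum>j<n. K i j * b j) powr p)
      \<le> (\<Sum>i<m. (C * u i) powr (p - 1) * (\<Sum>j<n. K i j * u j * (b j / u j) powr p))"
    by (intro sum_mono row)
  also have "\<dots> = (\<Sum>i<m. \<Sum>j<n.
      C powr (p - 1) * (u j * (b j / u j) powr p) * (K i j * u i powr (p - 1)))"
    by (simp add: sum_distrib_left powr_mult mult_ac)
  \<comment> \<open>After the sums are swapped, the inner sum over \<open>i\<close> is the one that
    the column hypothesis bounds.\<close>
  also have "\<dots> = (\<Sum>j<n. C powr (p - 1) * (u j * (b j / u j) powr p) *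
      (\<Sum>i<m. K i j * u i powr (p - 1)))"
    by (subst sum.swap) (simp add: sum_distrib_left)
  also have "\<dots> \<le> (\<Sum>j<n. C powr (p - 1) * (u j * (b j / u j) powr p) * (C * u j powr (p - 1)))"
    using u by (intro sum_mono mult_left_mono cols) (auto intro!: mult_nonneg_nonneg divide_nonneg_pos intro: less_imp_le)
  also have "\<dots> = (\<Sum>j<n. C powr p * b j powr p)"
  proof (rule sum.cong[OF refl])
    fix j
    have "C powr (p - 1) * C = C powr p"
      using C p by (cases "C = 0") (auto simp: powr_diff)
    moreover have "u j * (b j / u j) powr p * u j powr (p - 1) = b j powr p"
      using u[of j] by (simp add: powr_divide powr_diff)
    ultimately show "C powr (p - 1) * (u j * (b j / u j) powr p) * (C * u j powr (p - 1))
        = C powr p * b j powr p"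
      by (metis (no_types, opaque_lifting) mult.assoc mult.commute)
  qed
  finally show ?thesis
    by (simp add: sum_distrib_left)
qed

definition kernel_op :: "(nat \<Rightarrow> nat \<Rightarrow> real) \<Rightarrow> (nat \<Rightarrow> complex) \<Rightarrow> nat \<Rightarrow> complex" where
  "kernel_op K a i = (\<Sum>j. of_real (K i j) * a j)"

text \<open>The constant \<open>C\<close> need not be the operator norm. Absolute convergence of
  every row is included because \<open>suminf\<close> assigns a value to divergent series as
  well.\<close>

definition kernel_bound :: "real \<Rightarrow> (nat \<Rightarrow> nat \<Rightarrow> real) \<Rightarrow> real \<Rightarrow> bool" where
  "kernel_bound p K C \<longleftrightarrow> (\<forall>a\<in>lp_space p.
     (\<forall>i. summable (\<lambda>j. norm (of_real (K i j) * a j))) \<and>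
     kernel_op K a \<in> lp_space p \<and> lp_norm p (kernel_op K a) \<le> C * lp_norm p a)"

lemma lp_norm_le:
  assumes p: "p > 1" and B: "B \<ge> 0" and le: "\<And>n. (\<Sum>i<n. norm (a i) powr p) \<le> B powr p"
  shows "a \<in> lp_space p" "lp_norm p a \<le> B"
proof -
  show a: "a \<in> lp_space p"
    unfolding lp_space_def mem_Collect_eq by (rule summableI_nonneg_bounded) (use le in auto)
  then have "(\<Sum>i. norm (a i) powr p) \<le> B powr p"
    using le by (intro suminf_le_const) (auto simp: lp_space_def)
  moreover have "0 \<le> (\<Sum>i. norm (a i) powr p)"
    using a by (intro suminf_nonneg) (auto simp: lp_space_def)
  ultimately have "lp_norm p a \<le> (B powr p) powr (1 / p)"
    unfolding lp_norm_def using p by (intro powr_mono2) auto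
  then show "lp_norm p a \<le> B"
    using p B by (simp add: powr_powr)
qed

lemma sum_le_lp_norm_powr:
  assumes "p > 1" "a \<in> lp_space p" "finite I"
  shows "(\<Sum>i\<in>I. norm (a i) powr p) \<le> lp_norm p a powr p"
  using assms by (subst lp_norm_powr) (auto simp: lp_space_def intro!: sum_le_suminf)

text \<open>The finite inequality is uniform in the size of the section, so first the number of
  columns and then the number of rows may tend to infinity.\<close>

lemma schur_test:
  fixes K :: "nat \<Rightarrow> nat \<Rightarrow> real"
  assumes p: "p > 1" and C: "C \<ge> 0"
    and K: "\<And>i j. 0 \<le> K i j" and u: "\<And>i. 0 < u i"
    and rows: "\<And>i n. (\<Sum>j<n. K i j * u j) \<le> C * u i"
    and cols: "\<And>j n. (\<Sum>i<n. K i j * u i powr (p - 1)) \<le> C * u j powr (p - 1)"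
  shows "kernel_bound p K C"
  unfolding kernel_bound_def
proof (intro ballI conjI allI)
  fix a assume a: "a \<in> lp_space p"
  define B where "B = C * lp_norm p a"
  have B: "B \<ge> 0"
    using C by (simp add: B_def lp_norm_nonneg)
  have fin: "(\<Sum>i<m. (\<Sum>j<n. K i j * norm (a j)) powr p) \<le> B powr p" for m n
  proof -
    have "(\<Sum>i<m. (\<Sum>j<n. K i j * norm (a j)) powr p) \<le> C powr p * (\<Sum>j<n. norm (a j) powr p)"
      by (rule schur_test_finite[OF p C K u rows cols]) auto
    also have "\<dots> \<le> C powr p * lp_norm p a powr p"
      using sum_le_lp_norm_powr[OF p a] by (intro mult_left_mono) auto
    finally show ?thesis
      by (simp add: B_def powr_mult)
  qed
  have nonneg: "0 \<le> (\<Sum>j<n. K i j * norm (a j))" for i n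
    using K by (intro sum_nonneg) auto
  have summ: "summable (\<lambda>j. K i j * norm (a j))" for i
  proof (rule summableI_nonneg_bounded)
    fix n
    \<comment> \<open>A single row is one term of the sum over the first \<open>Suc i\<close> rows,
      so its partial sums stay below \<open>B\<close>.\<close>
    have "(\<Sum>j<n. K i j * norm (a j)) powr p
        \<le> (\<Sum>i<Suc i. (\<Sum>j<n. K i j * norm (a j)) powr p)"
      by (rule member_le_sum) auto
    then have "(\<Sum>j<n. K i j * norm (a j)) powr p \<le> B powr p"
      using fin[of n "Suc i"] by linarith
    then show "(\<Sum>j<n. K i j * norm (a j)) \<le> B"
      using B nonneg p powr_less_mono2[of p B "\<Sum>j<n. K i j * norm (a j)"] by force
  qed (use K in auto)
  then show "summable (\<lambda>j. norm (of_real (K i j) * a j))" for i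
    using K by (simp add: norm_mult)
  have "(\<Sum>i<m. norm (kernel_op K a i) powr p) \<le> B powr p" for m
  proof -
    have "(\<Sum>i<m. norm (kernel_op K a i) powr p) \<le> (\<Sum>i<m. (\<Sum>j. K i j * norm (a j)) powr p)"
    proof (intro sum_mono powr_mono2)
      fix i
      show "norm (kernel_op K a i) \<le> (\<Sum>j. K i j * norm (a j))"
        unfolding kernel_op_def using summable_norm[of "\<lambda>j. of_real (K i j) * a j"] summ[of i] K
        by (simp add: norm_mult)
    qed (use p in auto)
    also have "\<dots> \<le> B powr p"
    proof (rule LIMSEQ_le_const2)
      show "(\<lambda>n. \<Sum>i<m. (\<Sum>j<n. K i j * norm (a j)) powr p)
          \<longlonglongrightarrow> (\<Sum>i<m. (\<Sum>j. K i j * norm (a j)) powr p)"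
        using p nonneg by (intro tendsto_sum tendsto_powr' summable_LIMSEQ summ tendsto_const) auto
    qed (use fin in auto)
    finally show ?thesis .
  qed
  from lp_norm_le[OF p B this]
  show "kernel_op K a \<in> lp_space p" "lp_norm p (kernel_op K a) \<le> C * lp_norm p a"
    by (simp_all add: B_def)
qed

section \<open>Homogeneous kernels\<close>

text \<open>Comparison with the integral of x^(\<tau>-1). For \<tau> \<ge> 1 the last term is the
  largest and counting terms is enough; for \<tau> < 1 the terms decrease and the mean value theorem
  gives a telescoping bound.\<close>

lemma sum_powr_le:
  fixes \<tau> :: real
  assumes "\<tau> > 0"
  shows "(\<Sum>j<n. real (Suc j) powr (\<tau> - 1)) \<le> max 1 (1 / \<tau>) * real n powr \<tau>"
proof (cases "\<tau> \<ge> 1")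
  case True
  have "(\<Sum>j<n. real (Suc j) powr (\<tau> - 1)) \<le> (\<Sum>j<n. real n powr (\<tau> - 1))"
    using True by (intro sum_mono powr_mono2) auto
  also have "\<dots> = real n powr \<tau>"
    by (cases "n = 0") (auto simp: powr_diff)
  also have "\<dots> \<le> max 1 (1 / \<tau>) * real n powr \<tau>"
    by (rule mult_le_cancel_right1[THEN iffD2]) auto
  finally show ?thesis .
next
  case False
  have "(\<Sum>j<n. real (Suc j) powr (\<tau> - 1)) \<le> 1 / \<tau> * real n powr \<tau>"
  proof (induction n)
    case (Suc n)
    have "real (Suc n) powr (\<tau> - 1) \<le> 1 / \<tau> * (real (Suc n) powr \<tau> - real n powr \<tau>)"
    \<comment> \<open>For \<tau> < 1 the function \<open>x powr \<tau>\<close> is not differentiable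
      at 0, so the first interval is separate; there the claim is 1 \<le> 1 / \<tau>.\<close>
    proof (cases "n = 0")
      case True
      then show ?thesis using False assms by simp
    next
      case n: False
      have "\<exists>z>real n. z < real (Suc n) \<and>
          real (Suc n) powr \<tau> - real n powr \<tau> = (real (Suc n) - real n) * (\<tau> * z powr (\<tau> - 1))"
        using n by (intro MVT2) (auto intro!: derivative_eq_intros)
      then obtain z where z: "real n < z" "z < real (Suc n)"
          "real (Suc n) powr \<tau> - real n powr \<tau> = \<tau> * z powr (\<tau> - 1)"
        by auto
      have "real (Suc n) powr (\<tau> - 1) \<le> z powr (\<tau> - 1)"
        using z n False by (intro powr_mono2') auto
      then show ?thesis
        using assms unfolding z(3) by simp
    qed
    then show ?case
      using Suc.IH by (simp add: algebra_simps)
  qed simp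
  also have "\<dots> \<le> max 1 (1 / \<tau>) * real n powr \<tau>"
    by (intro mult_right_mono) auto
  finally show ?thesis .
qed

text \<open>By the mean value theorem each term is at most 1 / \<delta> times the drop of
  \<open>x powr (- \<delta>)\<close> over an interval of length 1. The induction keeps the
  subtracted endpoint value so that the drops telescope; it is discarded at the end.\<close>

lemma sum_powr_tail_le:
  fixes \<delta> :: real
  assumes "\<delta> > 0"
  shows "(\<Sum>j\<in>{i<..<n}. real (Suc j) powr (- 1 - \<delta>)) \<le> real (Suc i) powr (- \<delta>) / \<delta>"
proof (cases "n \<ge> Suc i")
  case True
  then have "(\<Sum>j\<in>{i<..<n}. real (Suc j) powr (- 1 - \<delta>))
      \<le> (real (Suc i) powr (- \<delta>) - real n powr (- \<delta>)) / \<delta>"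
  proof (induction n rule: dec_induct)
    case base
    have "{i<..<Suc i} = {}"
      by auto
    then show ?case
      by simp
  next
    case (step n)
    have n: "n \<ge> 1"
      using step by simp
    have "\<exists>z>real n. z < real (Suc n) \<and>
        - (real (Suc n) powr (- \<delta>)) - - (real n powr (- \<delta>))
          = (real (Suc n) - real n) * (\<delta> * z powr (- 1 - \<delta>))"
      using n by (intro MVT2) (auto intro!: derivative_eq_intros simp: minus_diff_commute)
    then obtain z where z: "real n < z" "z < real (Suc n)"
        "real n powr (- \<delta>) - real (Suc n) powr (- \<delta>) = \<delta> * z powr (- 1 - \<delta>)"
      by auto
    have "real (Suc n) powr (- 1 - \<delta>) \<le> z powr (- 1 - \<delta>)"
      using z n assms by (intro powr_mono2') auto
    also have "\<dots> = (real n powr (- \<delta>) - real (Suc n) powr (- \<delta>)) / \<delta>"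
      using assms unfolding z(3) by simp
    finally have "real (Suc n) powr (- 1 - \<delta>)
        \<le> (real n powr (- \<delta>) - real (Suc n) powr (- \<delta>)) / \<delta>" .
    moreover have "{i<..<Suc n} = insert n {i<..<n}"
      using step by auto
    ultimately show ?case
      using step.IH by (simp add: diff_divide_distrib)
  qed
  also have "\<dots> \<le> real (Suc i) powr (- \<delta>) / \<delta>"
    using assms by (intro divide_right_mono) auto
  finally show ?thesis .
qed (use assms in auto)

text \<open>The sum is split at j = i. Up to there the maximum is i and the terms are powers of j
  with exponent \<tau> - 1; beyond it the maximum is j and the exponent is -1 - \<delta>. The
  hypotheses say that \<tau> and \<delta> are positive, and by homogeneity both parts scale like the
  power -r of i + 1.\<close>

lemma homogeneous_kernel_row_sum:
  fixes \<alpha> \<beta> r :: real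
  assumes "\<alpha> + r > 0" "\<beta> + r < 1"
  obtains C where "C \<ge> 0"
    "\<And>i n. (\<Sum>j<n. real (Suc i) powr \<alpha> * real (Suc j) powr (- \<beta>) *
        real (Suc (max i j)) powr (- (1 + \<alpha> - \<beta>)) * real (Suc j) powr (- r))
      \<le> C * real (Suc i) powr (- r)"
proof
  define \<tau> where "\<tau> = 1 - \<beta> - r"
  define \<delta> where "\<delta> = \<alpha> + r"
  have pos: "\<tau> > 0" "\<delta> > 0"
    using assms by (auto simp: \<tau>_def \<delta>_def)
  show "max 1 (1 / \<tau>) + 1 / \<delta> \<ge> 0"
    using pos by (auto intro!: add_nonneg_nonneg simp: max_def)
  fix i n :: nat
  define x where "x = real (Suc i)"
  have x: "x > 0"
    by (simp add: x_def)
  let ?f = "\<lambda>j. x powr \<alpha> * real (Suc j) powr (- \<beta>) *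
        real (Suc (max i j)) powr (- (1 + \<alpha> - \<beta>)) * real (Suc j) powr (- r)"
  have "sum ?f {..<n} \<le> sum ?f ({..<Suc i} \<union> {i<..<n})"
    by (intro sum_mono2) auto
  also have "\<dots> = sum ?f {..<Suc i} + sum ?f {i<..<n}"
    by (intro sum.union_disjoint) auto
  also have "sum ?f {..<Suc i} = (\<Sum>j<Suc i. x powr (\<beta> - 1) * real (Suc j) powr (\<tau> - 1))"
  proof (rule sum.cong[OF refl])
    fix j assume "j \<in> {..<Suc i}"
    then have m: "real (Suc (max i j)) = x"
      by (simp add: x_def max_def)
    have "?f j = (x powr \<alpha> * x powr (- (1 + \<alpha> - \<beta>))) *
        (real (Suc j) powr (- \<beta>) * real (Suc j) powr (- r))"
      unfolding m by (simp add: mult_ac)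
    also have "\<dots> = x powr (\<beta> - 1) * real (Suc j) powr (\<tau> - 1)"
      unfolding powr_add[symmetric] by (simp add: \<tau>_def)
    finally show "?f j = x powr (\<beta> - 1) * real (Suc j) powr (\<tau> - 1)" .
  qed
  also have "\<dots> \<le> x powr (\<beta> - 1) * (max 1 (1 / \<tau>) * x powr \<tau>)"
    unfolding sum_distrib_left[symmetric] x_def
    by (intro mult_left_mono sum_powr_le pos) auto
  also have "\<dots> = max 1 (1 / \<tau>) * x powr (- r)"
    using x by (simp add: \<tau>_def powr_add[symmetric] mult.left_commute)
  also have "sum ?f {i<..<n} = (\<Sum>j\<in>{i<..<n}. x powr \<alpha> * real (Suc j) powr (- 1 - \<delta>))"
  proof (rule sum.cong[OF refl])
    fix j assume "j \<in> {i<..<n}"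
    then have m: "max i j = j"
      by simp
    have "?f j = x powr \<alpha> * (real (Suc j) powr (- \<beta>) * real (Suc j) powr (- (1 + \<alpha> - \<beta>)) *
        real (Suc j) powr (- r))"
      unfolding m by (simp add: mult_ac)
    also have "\<dots> = x powr \<alpha> * real (Suc j) powr (- 1 - \<delta>)"
      unfolding powr_add[symmetric] by (simp add: \<delta>_def algebra_simps)
    finally show "?f j = x powr \<alpha> * real (Suc j) powr (- 1 - \<delta>)" .
  qed
  also have "\<dots> \<le> x powr \<alpha> * (x powr (- \<delta>) / \<delta>)"
    unfolding sum_distrib_left[symmetric] x_def
    by (intro mult_left_mono sum_powr_tail_le pos) auto
  also have "\<dots> = 1 / \<delta> * x powr (- r)"
    using x by (simp add: \<delta>_def powr_add[symmetric])
  finally show "(\<Sum>j<n. real (Suc i) powr \<alpha> * real (Suc j) powr (- \<beta>) *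
        real (Suc (max i j)) powr (- (1 + \<alpha> - \<beta>)) * real (Suc j) powr (- r))
      \<le> (max 1 (1 / \<tau>) + 1 / \<delta>) * real (Suc i) powr (- r)"
    by (simp add: x_def distrib_right)
qed

text \<open>The Schur test with the weights \<open>?u\<close>. One constant \<open>C\<close> serves
  all kernels dominated by a multiple \<open>c\<close> of the model kernel, so a small
  \<open>c\<close> makes the bound small; this is how the tails of the operator are handled
  later.\<close>

lemma kernel_bound_homogeneous:
  fixes p \<alpha> \<beta> :: real
  assumes p: "p > 1" and \<alpha>: "- 1 / p < \<alpha>" "\<alpha> < 1 - 1 / p" and \<beta>: "- 1 / p < \<beta>" "\<beta> < 1 - 1 / p"
  shows "\<exists>C\<ge>0. \<forall>K c. c \<ge> 0 \<longrightarrow> (\<forall>i j. 0 \<le> K i j) \<longrightarrow>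
      (\<forall>i j. K i j \<le> c * (real (Suc i) powr \<alpha> * real (Suc j) powr (- \<beta>) *
        real (Suc (max i j)) powr (- (1 + \<alpha> - \<beta>)))) \<longrightarrow> kernel_bound p K (c * C)"
proof -
  let ?H = "\<lambda>i j. real (Suc i) powr \<alpha> * real (Suc j) powr (- \<beta>) *
        real (Suc (max i j)) powr (- (1 + \<alpha> - \<beta>))"
  let ?u = "\<lambda>i. real (Suc i) powr (- (1 / p))"
  obtain C1 where C1: "C1 \<ge> 0" "\<And>i n. (\<Sum>j<n. ?H i j * ?u j) \<le> C1 * ?u i"
    using homogeneous_kernel_row_sum[of \<alpha> "1 / p" \<beta>] \<alpha> \<beta> by auto
  \<comment> \<open>Column sums are row sums of the transposed kernel, in which (\<alpha>, \<beta>)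
    becomes (-\<beta>, -\<alpha>); the weight \<open>?u i powr (p - 1)\<close> has the exponent -(1
    - 1/p).\<close>
  obtain C2 where C2: "C2 \<ge> 0" "\<And>j n. (\<Sum>i<n. real (Suc j) powr (- \<beta>) * real (Suc i) powr (- (- \<alpha>)) *
        real (Suc (max j i)) powr (- (1 + - \<beta> - - \<alpha>)) * real (Suc i) powr (- (1 - 1 / p)))
        \<le> C2 * real (Suc j) powr (- (1 - 1 / p))"
    using homogeneous_kernel_row_sum[of "- \<beta>" "1 - 1 / p" "- \<alpha>"] \<alpha> \<beta> by auto
  have u: "?u i powr (p - 1) = real (Suc i) powr (- (1 - 1 / p))" for i
    using p by (simp add: powr_powr field_simps)
  have C2': "(\<Sum>i<n. ?H i j * ?u i powr (p - 1)) \<le> C2 * ?u j powr (p - 1)" for j n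
    using C2(2)[of j n] unfolding u by (simp add: mult_ac max.commute algebra_simps)
  show ?thesis
  proof (intro exI[of _ "max C1 C2"] conjI allI impI)
    show "max C1 C2 \<ge> 0"
      using C1 by simp
    fix K :: "nat \<Rightarrow> nat \<Rightarrow> real" and c :: real
    assume c: "c \<ge> 0" and K: "\<forall>i j. 0 \<le> K i j" and le: "\<forall>i j. K i j \<le> c * ?H i j"
    show "kernel_bound p K (c * max C1 C2)"
    proof (rule schur_test[OF p, where u = ?u])
      fix i n
      have "(\<Sum>j<n. K i j * ?u j) \<le> (\<Sum>j<n. c * ?H i j * ?u j)"
        using le by (intro sum_mono mult_right_mono) auto
      also have "\<dots> = c * (\<Sum>j<n. ?H i j * ?u j)"
        by (simp add: sum_distrib_left mult.assoc)
      also have "\<dots> \<le> c * (C1 * ?u i)"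
        by (intro mult_left_mono C1 c)
      also have "\<dots> \<le> c * (max C1 C2 * ?u i)"
        using c by (intro mult_left_mono mult_right_mono) auto
      finally show "(\<Sum>j<n. K i j * ?u j) \<le> c * max C1 C2 * ?u i"
        by (simp add: mult.assoc)
    next
      fix j n
      have "(\<Sum>i<n. K i j * ?u i powr (p - 1)) \<le> (\<Sum>i<n. c * ?H i j * ?u i powr (p - 1))"
        using le by (intro sum_mono mult_right_mono) auto
      also have "\<dots> = c * (\<Sum>i<n. ?H i j * ?u i powr (p - 1))"
        by (simp add: sum_distrib_left mult.assoc)
      also have "\<dots> \<le> c * (C2 * ?u j powr (p - 1))"
        by (intro mult_left_mono C2' c)
      also have "\<dots> \<le> c * (max C1 C2 * ?u j powr (p - 1))"
        using c by (intro mult_left_mono mult_right_mono) auto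
      finally show "(\<Sum>i<n. K i j * ?u i powr (p - 1)) \<le> c * max C1 C2 * ?u j powr (p - 1)"
        by (simp add: mult.assoc)
    qed (use c C1 K in auto)
  qed
qed

section \<open>Moments and Carleson conditions\<close>

text \<open>\<open>R\<close> stands for \<rho>, so that the moment estimates do not involve
  \<lambda> and its weight.\<close>

locale finite_borel_01 = finite_measure R for R :: "real measure" +
  assumes borel_01: "borel_measure_01 R"
begin

definition moment :: "nat \<Rightarrow> real" where
  "moment k = (\<integral>t. t ^ k \<partial>R)"

lemma space_01: "space R = {0..<1}"
  using sets_eq_imp_space_eq[OF borel_01[unfolded borel_measure_01_def]]
  by (simp add: space_restrict_space)

lemma tail_sets: "0 \<le> t \<Longrightarrow> {t..<1} \<in> sets R"
  using borel_01 by (auto simp: borel_measure_01_def sets_restrict_space_iff)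

lemma integrable_power: "integrable R (\<lambda>t. t ^ k)"
proof (rule integrable_const_bound[where B = 1])
  show "AE t in R. norm (t ^ k) \<le> 1"
    by (auto simp: space_01 power_le_one power_abs[symmetric])
  have "(\<lambda>t::real. t ^ k) \<in> borel_measurable (restrict_space borel {0..<1})"
    by (intro measurable_restrict_space1) simp
  then show "(\<lambda>t. t ^ k) \<in> borel_measurable R"
    using borel_01 measurable_cong_sets[of R _ borel borel] by (auto simp: borel_measure_01_def)
qed

lemma moment_nonneg: "0 \<le> moment k"
  unfolding moment_def by (rule Bochner_Integration.integral_nonneg) (auto simp: space_01)

lemma integral_indicator_tail:
  "0 \<le> t \<Longrightarrow> integrable R (indicat_real {t..<1})"
  "0 \<le> t \<Longrightarrow> (\<integral>x. indicat_real {t..<1} x \<partial>R) = measure R {t..<1}"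
  using tail_sets[of t] by (auto simp: space_01 less_top[symmetric] Int_absorb2
      intro!: integrable_real_indicator arg_cong[where f = "measure R"])

text \<open>Markov's inequality: \<open>x ^ k\<close> is at least \<open>t ^ k\<close> on [t,
  1).\<close>

lemma tail_le_moment:
  assumes "0 \<le> t"
  shows "t ^ k * measure R {t..<1} \<le> moment k"
proof -
  have "(\<integral>x. t ^ k * indicat_real {t..<1} x \<partial>R) \<le> moment k"
    unfolding moment_def
    by (intro integral_mono integrable_power integrable_mult_right integral_indicator_tail assms)
      (use assms in \<open>auto simp: space_01 indicator_def intro!: power_mono\<close>)
  then show ?thesis
    using integral_indicator_tail(2)[OF assms] by simp
qed

text \<open>The point x is assigned to the shell j = floor((k + 1)(1 - x)), which lies in the tail
  from 1 - (j + 1)/(k + 1) on. There x^k \<le> exp(-k(1 - x)) \<le> exp(1 - j), where the 1 in the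
  exponent pays for replacing k by k + 1. The \<open>max 0\<close> keeps the tails inside [0,
  1).\<close>

lemma moment_le_sum_tails:
  "moment k \<le> (\<Sum>j\<le>Suc k. exp (1 - real j) *
     measure R {max 0 (1 - real (Suc j) / real (Suc k))..<1})"
proof -
  let ?t = "\<lambda>j. max 0 (1 - real (Suc j) / real (Suc k))"
  have "x ^ k \<le> (\<Sum>j\<le>Suc k. exp (1 - real j) * indicat_real {?t j..<1} x)" if "x \<in> space R" for x
  proof -
    have x: "0 \<le> x" "x < 1"
      using that by (auto simp: space_01)
    define y where "y = real (Suc k) * (1 - x)"
    define j where "j = nat \<lfloor>y\<rfloor>"
    have y: "0 \<le> y" "y \<le> real (Suc k)"
      using x by (auto simp: y_def intro: mult_left_le)
    have j: "real j \<le> y" "y < real (Suc j)"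
      using y unfolding j_def by linarith+
    have jk: "j \<le> Suc k"
      using j(1) y(2) by linarith
    have "1 - real (Suc j) / real (Suc k) \<le> x"
    proof -
      have "1 - x = y / real (Suc k)"
        by (simp add: y_def)
      also have "\<dots> \<le> real (Suc j) / real (Suc k)"
        using j(2) by (intro divide_right_mono) auto
      finally show ?thesis by simp
    qed
    then have ind: "indicat_real {?t j..<1} x = 1"
      using x by simp
    have "x ^ k \<le> exp (x - 1) ^ k"
      using x exp_ge_add_one_self[of "x - 1"] by (intro power_mono) auto
    also have "\<dots> = exp ((1 - x) - y)"
      by (simp add: exp_of_nat_mult[symmetric] y_def algebra_simps)
    also have "\<dots> \<le> exp (1 - real j)"
      using x j by simp
    also have "\<dots> = exp (1 - real j) * indicat_real {?t j..<1} x"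
      by (simp only: ind mult_1_right)
    also have "\<dots> \<le> (\<Sum>j\<le>Suc k. exp (1 - real j) * indicat_real {?t j..<1} x)"
      using jk by (intro member_le_sum) auto
    finally show ?thesis .
  qed
  then have "moment k \<le> (\<integral>x. (\<Sum>j\<le>Suc k. exp (1 - real j) * indicat_real {?t j..<1} x) \<partial>R)"
    unfolding moment_def
    by (intro integral_mono integrable_power Bochner_Integration.integrable_sum
        integrable_mult_right integral_indicator_tail) auto
  also have "\<dots> = (\<Sum>j\<le>Suc k. exp (1 - real j) * measure R {?t j..<1})"
    by (subst Bochner_Integration.integral_sum)
      (simp_all only: integrable_mult_right integral_mult_right_zero integral_indicator_tail
        max.cobounded1)
  finally show ?thesis .
qed

end

text \<open>These series are the constants in the moment estimate: the tail attached to shell j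
  grows like a power of j + 1, and the exponential weight outweighs it.\<close>

lemma summable_exp_powr: "summable (\<lambda>j. exp (1 - real j) * real (Suc j) powr \<sigma>)"
proof (rule summable_comparison_test_bigo)
  show "summable (\<lambda>j. norm (1 / real j ^ 2))"
    using inverse_power_summable[of 2, where 'a = real] by (simp add: field_simps)
  show "(\<lambda>j. exp (1 - real j) * real (Suc j) powr \<sigma>) \<in> O(\<lambda>j. 1 / real j ^ 2)"
    by real_asymp
qed

context finite_borel_01
begin

text \<open>Two exponents: a vanishing Carleson measure satisfies the hypothesis with
  \<open>\<sigma>' = \<sigma> + 1\<close> and arbitrarily small \<open>A\<close>, and the second term is then of lower order.\<close>

lemma moment_le:
  assumes \<sigma>: "\<sigma> > 0" "\<sigma>' > 0" and A: "A \<ge> 0" "A' \<ge> 0"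
    and le: "\<And>t. 0 \<le> t \<Longrightarrow> t < 1 \<Longrightarrow>
      measure R {t..<1} \<le> A * (1 - t) powr \<sigma> + A' * (1 - t) powr \<sigma>'"
  shows "moment k \<le> A * (\<Sum>j. exp (1 - real j) * real (Suc j) powr \<sigma>) * real (Suc k) powr (- \<sigma>)
      + A' * (\<Sum>j. exp (1 - real j) * real (Suc j) powr \<sigma>') * real (Suc k) powr (- \<sigma>')"
proof -
  let ?S = "\<lambda>\<sigma>. \<Sum>j. exp (1 - real j) * real (Suc j) powr \<sigma>"
  have part: "(\<Sum>j\<le>Suc k. exp (1 - real j) * (A * (real (Suc j) / real (Suc k)) powr \<sigma>))
      \<le> A * ?S \<sigma> * real (Suc k) powr (- \<sigma>)" if "A \<ge> 0" for A \<sigma>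
  proof -
    have "(\<Sum>j\<le>Suc k. exp (1 - real j) * (A * (real (Suc j) / real (Suc k)) powr \<sigma>))
        = A * real (Suc k) powr (- \<sigma>) * (\<Sum>j\<le>Suc k. exp (1 - real j) * real (Suc j) powr \<sigma>)"
      unfolding sum_distrib_left
      by (intro sum.cong refl) (simp add: powr_divide powr_minus field_simps)
    also have "\<dots> \<le> A * real (Suc k) powr (- \<sigma>) * ?S \<sigma>"
      using that by (intro mult_left_mono sum_le_suminf summable_exp_powr) auto
    finally show ?thesis by (simp add: mult_ac)
  qed
  have "moment k \<le> (\<Sum>j\<le>Suc k. exp (1 - real j) *
      (A * (real (Suc j) / real (Suc k)) powr \<sigma> + A' * (real (Suc j) / real (Suc k)) powr \<sigma>'))"
  proof (rule order_trans[OF moment_le_sum_tails], intro sum_mono mult_left_mono)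
    fix j
    define t where "t = max 0 (1 - real (Suc j) / real (Suc k))"
    have t: "0 \<le> t" "t < 1" "1 - t \<le> real (Suc j) / real (Suc k)"
      by (auto simp: t_def)
    have "measure R {t..<1} \<le> A * (1 - t) powr \<sigma> + A' * (1 - t) powr \<sigma>'"
      using le t by simp
    also have "\<dots> \<le> A * (real (Suc j) / real (Suc k)) powr \<sigma> + A' * (real (Suc j) / real (Suc k)) powr \<sigma>'"
      using t \<sigma> A by (intro add_mono mult_left_mono powr_mono2) auto
    finally show "measure R {max 0 (1 - real (Suc j) / real (Suc k))..<1}
        \<le> A * (real (Suc j) / real (Suc k)) powr \<sigma> + A' * (real (Suc j) / real (Suc k)) powr \<sigma>'"
      by (simp add: t_def)
  qed simp
  also have "\<dots> = (\<Sum>j\<le>Suc k. exp (1 - real j) * (A * (real (Suc j) / real (Suc k)) powr \<sigma>))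
      + (\<Sum>j\<le>Suc k. exp (1 - real j) * (A' * (real (Suc j) / real (Suc k)) powr \<sigma>'))"
    by (simp only: distrib_left sum.distrib)
  also have "\<dots> \<le> A * ?S \<sigma> * real (Suc k) powr (- \<sigma>) + A' * ?S \<sigma>' * real (Suc k) powr (- \<sigma>')"
    by (intro add_mono part A)
  finally show ?thesis .
qed

text \<open>The hypothesis makes the tails small only near 1. Elsewhere the finite total mass is
  absorbed into a term with exponent s + 1, which still decays like 1/(k + 1) after multiplication
  by (k + 1)^s.\<close>

lemma moment_tendsto_0:
  assumes s: "s > 0" and van: "((\<lambda>t. measure R {t..<1} / (1 - t) powr s) \<longlongrightarrow> 0) (at_left 1)"
  shows "(\<lambda>k. real (Suc k) powr s * moment k) \<longlonglongrightarrow> 0"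
proof (rule tendstoI)
  fix e :: real assume e: "e > 0"
  let ?S = "\<lambda>\<sigma>. \<Sum>j. exp (1 - real j) * real (Suc j) powr \<sigma>"
  have S: "?S \<sigma> \<ge> 0" for \<sigma>
    by (intro suminf_nonneg summable_exp_powr) auto
  \<comment> \<open>Chosen so that the leading term \<open>A * ?S s\<close> is below
    \<open>e\<close>; the added 1 keeps the denominator positive.\<close>
  define A where "A = e / (2 * (?S s + 1))"
  have A: "A > 0" and AS: "A * ?S s < e"
  proof -
    show "A > 0"
      using e S[of s] by (simp add: A_def)
    have "A * ?S s < A * (2 * (?S s + 1))"
      using \<open>A > 0\<close> S[of s] by (intro mult_strict_left_mono) auto
    also have "\<dots> = e"
      using S[of s] by (simp add: A_def add_nonneg_eq_0_iff)
    finally show "A * ?S s < e" .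
  qed
  have "eventually (\<lambda>t. measure R {t..<1} / (1 - t) powr s < A) (at_left 1)"
    using van A by (rule order_tendstoD)
  then obtain t0 where t0: "t0 < 1" "\<And>t. t0 < t \<Longrightarrow> t < 1 \<Longrightarrow> measure R {t..<1} / (1 - t) powr s < A"
    by (auto simp: eventually_at_left_field)
  \<comment> \<open>With this value \<open>B * (1 - t) powr (s + 1)\<close> is at least the total
    mass whenever t \<le> t0.\<close>
  define B where "B = measure R (space R) / (1 - t0) powr (s + 1)"
  have B: "B \<ge> 0"
    by (simp add: B_def)
  have tail: "measure R {t..<1} \<le> A * (1 - t) powr s + B * (1 - t) powr (s + 1)"
    if t: "0 \<le> t" "t < 1" for t
  proof (cases "t0 < t")
    case True
    then have "measure R {t..<1} \<le> A * (1 - t) powr s"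
      using t0(2)[of t] t by (simp add: divide_less_eq)
    then show ?thesis
      using B by (simp add: add_increasing2)
  next
    case False
    have "measure R {t..<1} \<le> measure R (space R)"
      by (rule bounded_measure)
    also have "\<dots> = B * (1 - t0) powr (s + 1)"
      using t0 by (simp add: B_def)
    also have "\<dots> \<le> B * (1 - t) powr (s + 1)"
      using False t0 s B by (intro mult_left_mono powr_mono2) auto
    finally show ?thesis
      using A by (simp add: add_increasing)
  qed
  have le: "real (Suc k) powr s * moment k \<le> A * ?S s + B * ?S (s + 1) * real (Suc k) powr (- 1)" for k
  proof -
    have "real (Suc k) powr s * moment k \<le> real (Suc k) powr s *
        (A * ?S s * real (Suc k) powr (- s) + B * ?S (s + 1) * real (Suc k) powr (- (s + 1)))"
      using s A B tail by (intro mult_left_mono moment_le) auto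
    also have "\<dots> = A * ?S s * (real (Suc k) powr s * real (Suc k) powr (- s))
        + B * ?S (s + 1) * (real (Suc k) powr s * real (Suc k) powr (- (s + 1)))"
      by (simp only: distrib_left mult_ac)
    also have "\<dots> = A * ?S s + B * ?S (s + 1) * real (Suc k) powr (- 1)"
      unfolding powr_add[symmetric] by simp
    finally show ?thesis .
  qed
  have "(\<lambda>k. A * ?S s + B * ?S (s + 1) * real (Suc k) powr (- 1)) \<longlonglongrightarrow> A * ?S s + B * ?S (s + 1) * 0"
    by (intro tendsto_intros) real_asymp
  then have "eventually (\<lambda>k. A * ?S s + B * ?S (s + 1) * real (Suc k) powr (- 1) < e) sequentially"
    using AS by (intro order_tendstoD(2)) auto
  then show "eventually (\<lambda>k. dist (real (Suc k) powr s * moment k) 0 < e) sequentially"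
  proof eventually_elim
    case (elim k)
    then show ?case
      using le[of k] moment_nonneg[of k] by simp
  qed
qed

text \<open>The limit bounds the quotient by 1 near the endpoint, and the finite total mass bounds
  it away from there, so the Carleson condition follows from the limit.\<close>

lemma vanishing_carlesonI:
  assumes s: "s > 0" and van: "((\<lambda>t. measure R {t..<1} / (1 - t) powr s) \<longlongrightarrow> 0) (at_left 1)"
  shows "vanishing_carleson s R"
proof -
  have "eventually (\<lambda>t. measure R {t..<1} / (1 - t) powr s < 1) (at_left 1)"
    using van by (rule order_tendstoD) simp
  then obtain t0 where t0: "t0 < 1" "\<And>t. t0 < t \<Longrightarrow> t < 1 \<Longrightarrow> measure R {t..<1} / (1 - t) powr s < 1"
    by (auto simp: eventually_at_left_field)
  define C where "C = 1 + measure R (space R) / (1 - t0) powr s"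
  have "C > 0"
    by (simp add: C_def add_pos_nonneg)
  moreover have "measure R {t..<1} \<le> C * (1 - t) powr s" if t: "t \<in> {0..<1}" for t
  proof (cases "t0 < t")
    case True
    then have "measure R {t..<1} \<le> 1 * (1 - t) powr s"
      using t0(2)[of t] t by (simp add: divide_less_eq)
    also have "\<dots> \<le> C * (1 - t) powr s"
      by (intro mult_right_mono) (auto simp: C_def)
    finally show ?thesis .
  next
    case False
    have "measure R {t..<1} \<le> measure R (space R)"
      by (rule bounded_measure)
    also have "\<dots> = measure R (space R) / (1 - t0) powr s * (1 - t0) powr s"
      using t0 by simp
    also have "\<dots> \<le> C * (1 - t) powr s"
      using False t0 s t by (intro mult_mono powr_mono2) (auto simp: C_def)
    finally show ?thesis .
  qed
  ultimately show ?thesis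
    using van unfolding vanishing_carleson_def carleson_def
    by (auto simp: emeasure_eq_measure intro!: ennreal_leI exI[of _ C])
qed

text \<open>Markov's inequality at t = 1 - 1/(n + 1). This t is the reciprocal of 1 + 1/n, and (1 +
  1/n)^n \<le> e, so t^(2n) \<ge> exp(-2). The index 2n matches the moment that the test vectors on
  [N, 2N) control.\<close>

lemma tail_le_double_moment:
  "exp (- 2) * measure R {1 - 1 / real (Suc n)..<1} \<le> moment (2 * n)"
proof -
  have "exp (- 1) \<le> (1 - 1 / real (Suc n)) ^ n"
  proof (cases "n = 0")
    case False
    have "(1 + 1 / real n) ^ n \<le> exp (1 / real n) ^ n"
      by (intro power_mono exp_ge_add_one_self add_nonneg_nonneg) auto
    also have "\<dots> = exp 1"
      using False by (simp add: exp_of_nat_mult[symmetric])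
    finally have "inverse (exp 1) \<le> inverse ((1 + 1 / real n) ^ n)"
      by (intro le_imp_inverse_le zero_less_power add_pos_nonneg) auto
    also have "\<dots> = (1 - 1 / real (Suc n)) ^ n"
      unfolding power_inverse[symmetric] using False by (simp add: field_simps)
    finally show ?thesis
      by (simp add: exp_minus)
  qed simp
  then have "exp (- 1) ^ 2 \<le> ((1 - 1 / real (Suc n)) ^ n) ^ 2"
    by (intro power_mono) auto
  then have "exp (- 2) \<le> (1 - 1 / real (Suc n)) ^ (2 * n)"
    by (simp add: exp_of_nat_mult[symmetric] power_mult[symmetric] mult.commute)
  then have "exp (- 2) * measure R {1 - 1 / real (Suc n)..<1}
      \<le> (1 - 1 / real (Suc n)) ^ (2 * n) * measure R {1 - 1 / real (Suc n)..<1}"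
    by (intro mult_right_mono) auto
  also have "\<dots> \<le> moment (2 * n)"
    by (intro tail_le_moment) auto
  finally show ?thesis .
qed

lemma vanishing_carleson_of_double_moment:
  assumes s: "s > 0" and lim: "(\<lambda>n. real n powr s * moment (2 * n)) \<longlonglongrightarrow> 0"
  shows "vanishing_carleson s R"
proof (rule vanishing_carlesonI[OF s])
  \<comment> \<open>Subtracting 1 gives N(t) + 1 \<le> 1/(1 - t), so [t, 1) lies in the tail from 1
    - 1/(N(t) + 1) on.\<close>
  define N where "N t = nat \<lfloor>1 / (1 - t)\<rfloor> - 1" for t :: real
  have N: "filterlim N sequentially (at_left 1)"
  proof -
    have "filterlim (\<lambda>t::real. 1 / (1 - t)) at_top (at_left 1)"
      by real_asymp
    then have "filterlim (\<lambda>t::real. nat \<lfloor>1 / (1 - t)\<rfloor>) sequentially (at_left 1)"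
      by (intro filterlim_compose[OF filterlim_nat_sequentially]
          filterlim_compose[OF filterlim_floor_sequentially])
    then show ?thesis
      unfolding N_def by (rule filterlim_compose[OF filterlim_minus_const_nat_at_top])
  qed
  have bound: "measure R {t..<1} / (1 - t) powr s \<le> exp 2 * 3 powr s * (real (N t) powr s * moment (2 * N t))"
    if t: "1 / 2 < t" "t < 1" for t
  proof -
    define x where "x = 1 / (1 - t)"
    have x: "x \<ge> 2" "1 - t = 1 / x"
      using t by (auto simp: x_def field_simps)
    \<comment> \<open>As N(t) \<ge> 1, the upper bound N(t) + 2 is at most 3 N(t); this is the
      source of the factor \<open>3 powr s\<close>.\<close>
    have Nx: "N t \<ge> 1" "real (Suc (N t)) \<le> x" "x < real (N t) + 2"
      using x(1) unfolding N_def x_def[symmetric] by linarith+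
    have "1 / x \<le> 1 / real (Suc (N t))"
      using Nx x by (intro divide_left_mono) auto
    then have "{t..<1} \<subseteq> {1 - 1 / real (Suc (N t))..<1}"
      using x(2) by auto
    then have "measure R {t..<1} \<le> measure R {1 - 1 / real (Suc (N t))..<1}"
      by (intro finite_measure_mono tail_sets) auto
    also have "\<dots> = exp 2 * (exp (- 2) * measure R {1 - 1 / real (Suc (N t))..<1})"
      by (simp add: exp_minus)
    also have "\<dots> \<le> exp 2 * moment (2 * N t)"
      by (intro mult_left_mono tail_le_double_moment) auto
    finally have m: "measure R {t..<1} \<le> exp 2 * moment (2 * N t)" .
    have "x powr s \<le> (3 * real (N t)) powr s"
      using x Nx s by (intro powr_mono2) auto
    then have "measure R {t..<1} * x powr s \<le> exp 2 * moment (2 * N t) * (3 * real (N t)) powr s"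
      using m by (intro mult_mono) (auto intro!: mult_nonneg_nonneg moment_nonneg)
    moreover have "measure R {t..<1} / (1 - t) powr s = measure R {t..<1} * x powr s"
      using x by (simp add: powr_divide)
    ultimately show ?thesis
      by (simp add: powr_mult mult_ac)
  qed
  have "((\<lambda>t. exp 2 * 3 powr s * (real (N t) powr s * moment (2 * N t))) \<longlongrightarrow> exp 2 * 3 powr s * 0) (at_left 1)"
    by (intro tendsto_mult tendsto_const filterlim_compose[OF lim N])
  then have lim': "((\<lambda>t. exp 2 * 3 powr s * (real (N t) powr s * moment (2 * N t))) \<longlongrightarrow> 0) (at_left 1)"
    by simp
  have ev: "eventually (\<lambda>t::real. 1 / 2 < t \<and> t < 1) (at_left 1)"
    by (auto simp: eventually_at_left_field intro!: exI[of _ "1 / 2"])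
  show "((\<lambda>t. measure R {t..<1} / (1 - t) powr s) \<longlongrightarrow> 0) (at_left 1)"
  proof (rule tendsto_sandwich[OF _ _ tendsto_const lim'])
    show "eventually (\<lambda>t. 0 \<le> measure R {t..<1} / (1 - t) powr s) (at_left 1)"
      by (intro always_eventually) auto
    show "eventually (\<lambda>t. measure R {t..<1} / (1 - t) powr s
        \<le> exp 2 * 3 powr s * (real (N t) powr s * moment (2 * N t))) (at_left 1)"
      using ev by eventually_elim (use bound in auto)
  qed
qed

end

section \<open>Compact kernel operators\<close>

text \<open>Plays the role of weak sequential compactness of the unit ball. All coordinates lie in
  the closed unit disc, so Tychonoff's theorem applies; the norm bound passes to the limit through
  finite partial sums.\<close>

lemma lp_ball_subsequence:
  fixes \<sigma> :: "nat \<Rightarrow> nat \<Rightarrow> complex"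
  assumes p: "p > 1" and \<sigma>: "\<And>k. \<sigma> k \<in> lp_space p" "\<And>k. lp_norm p (\<sigma> k) \<le> 1"
  obtains a r where "a \<in> lp_space p" "lp_norm p a \<le> 1" "strict_mono r"
    "\<And>i. (\<lambda>k. \<sigma> (r k) i) \<longlonglongrightarrow> a i"
proof -
  have part: "(\<Sum>i\<in>I. norm (\<sigma> k i) powr p) \<le> 1" if "finite I" for k I
  proof -
    have "lp_norm p (\<sigma> k) powr p \<le> 1 powr p"
      using p \<sigma> by (intro powr_mono2 lp_norm_nonneg) auto
    then show ?thesis
      using sum_le_lp_norm_powr[OF p \<sigma>(1) that, of k] by simp
  qed
  have "norm (\<sigma> k i) \<le> 1" for k i
  proof (rule ccontr)
    assume "\<not> norm (\<sigma> k i) \<le> 1"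
    then have "1 powr p < norm (\<sigma> k i) powr p"
      using p by (intro powr_less_mono2) auto
    then show False
      using part[of "{i}" k] by simp
  qed
  then have range: "\<forall>k. \<sigma> k \<in> PiE UNIV (\<lambda>_. cball 0 1)"
    by (auto simp: PiE_UNIV_domain)
  have "compactin (product_topology (\<lambda>i. euclidean) UNIV)
      (PiE (UNIV :: nat set) (\<lambda>_. cball (0 :: complex) 1))"
    unfolding compactin_PiE by simp
  then have "compact (PiE (UNIV :: nat set) (\<lambda>_. cball (0 :: complex) 1))"
    unfolding euclidean_product_topology by simp
  \<comment> \<open>The index set is countable, so the product is first countable and compactness
    yields convergent subsequences.\<close>
  then have "seq_compact (PiE (UNIV :: nat set) (\<lambda>_. cball (0 :: complex) 1))"
    by (rule compact_imp_seq_compact)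
  then obtain a r where r: "strict_mono r" and lim: "(\<sigma> \<circ> r) \<longlonglongrightarrow> a"
    using range by (elim seq_compactE) auto
  have coord: "(\<lambda>k. \<sigma> (r k) i) \<longlonglongrightarrow> a i" for i
  proof -
    have "limitin (product_topology (\<lambda>i. euclidean) UNIV) (\<sigma> \<circ> r) a sequentially"
      unfolding euclidean_product_topology using lim by simp
    then show ?thesis
      by (auto simp: limitin_componentwise o_def)
  qed
  have "(\<Sum>i<n. norm (a i) powr p) \<le> 1 powr p" for n
  proof (rule LIMSEQ_le_const2)
    show "(\<lambda>k. \<Sum>i<n. norm (\<sigma> (r k) i) powr p) \<longlonglongrightarrow> (\<Sum>i<n. norm (a i) powr p)"
      using p coord by (intro tendsto_intros tendsto_powr') auto
  qed (use part in auto)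
  from lp_norm_le[OF p _ this] show thesis
    using that r coord by auto
qed

lemma kernel_boundD:
  assumes "kernel_bound p K C" "a \<in> lp_space p"
  shows "summable (\<lambda>j. of_real (K i j) * a j)" "kernel_op K a \<in> lp_space p"
    "lp_norm p (kernel_op K a) \<le> C * lp_norm p a"
  using assms by (auto simp: kernel_bound_def intro: summable_norm_cancel)

lemma bounded_linear_on_lp_kernel_op:
  assumes K: "kernel_bound p K C"
  shows "bounded_linear_on_lp p (kernel_op K)"
  unfolding bounded_linear_on_lp_def
proof (intro conjI ballI allI)
  show "kernel_op K ` lp_space p \<subseteq> lp_space p"
    using kernel_boundD[OF K] by auto
  show "\<exists>C. \<forall>a\<in>lp_space p. lp_norm p (kernel_op K a) \<le> C * lp_norm p a"
    using kernel_boundD(3)[OF K] by blast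
  fix a b c assume a: "a \<in> lp_space p"
  show "kernel_op K (\<lambda>i. c * a i) = (\<lambda>i. c * kernel_op K a i)"
    using kernel_boundD(1)[OF K a] by (intro ext) (simp add: kernel_op_def mult.left_commute suminf_mult)
  assume b: "b \<in> lp_space p"
  show "kernel_op K (\<lambda>i. a i + b i) = (\<lambda>i. kernel_op K a i + kernel_op K b i)"
    using kernel_boundD(1)[OF K a] kernel_boundD(1)[OF K b]
    by (auto simp: kernel_op_def suminf_add distrib_left)
qed

lemma kernel_op_diff:
  assumes K: "kernel_bound p K C" and a: "a \<in> lp_space p" and b: "b \<in> lp_space p"
  shows "kernel_op K (\<lambda>i. a i - b i) = (\<lambda>i. kernel_op K a i - kernel_op K b i)"
  using kernel_boundD(1)[OF K a] kernel_boundD(1)[OF K b]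
  by (auto simp: kernel_op_def suminf_diff right_diff_distrib)

text \<open>The block of the kernel with both indices below \<open>N\<close> sees finitely many
  coordinates, and the rest has small norm uniformly on the ball. Hence a coordinatewise convergent
  subsequence in the ball has norm convergent images.\<close>

lemma compact_on_lp_kernel_op:
  assumes p: "p > 1" and K: "kernel_bound p K C"
    and tails: "\<And>e. e > 0 \<Longrightarrow> \<exists>N. kernel_bound p (\<lambda>i j. if max i j < N then 0 else K i j) e"
  shows "compact_on_lp p (kernel_op K)"
proof -
  interpret Metric_space "lp_space p" "lp_dist p"
    using p by (intro Metric_space_lp) auto
  let ?B = "{a \<in> lp_space p. lp_norm p a \<le> 1}"
  have "compactin mtopology (kernel_op K ` ?B)"
    unfolding compactin_sequentially
  proof (intro conjI allI impI)
    show "kernel_op K ` ?B \<subseteq> lp_space p"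
      using kernel_boundD[OF K] by auto
    fix \<tau> :: "nat \<Rightarrow> nat \<Rightarrow> complex" assume "range \<tau> \<subseteq> kernel_op K ` ?B"
    then have "\<forall>k. \<exists>a\<in>?B. \<tau> k = kernel_op K a"
      by blast
    then obtain \<sigma> where "\<forall>k. \<sigma> k \<in> ?B \<and> \<tau> k = kernel_op K (\<sigma> k)"
      by metis
    then have \<sigma>: "\<And>k. \<sigma> k \<in> lp_space p" "\<And>k. lp_norm p (\<sigma> k) \<le> 1" "\<And>k. \<tau> k = kernel_op K (\<sigma> k)"
      by auto
    obtain a r where a: "a \<in> lp_space p" "lp_norm p a \<le> 1" and r: "strict_mono r"
        and lim: "\<And>i. (\<lambda>k. \<sigma> (r k) i) \<longlonglongrightarrow> a i"
      by (rule lp_ball_subsequence[of p \<sigma>, OF p \<sigma>(1,2)]) (rule that)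
    define d where "d k = (\<lambda>i. \<sigma> (r k) i - a i)" for k
    have d: "d k \<in> lp_space p" "lp_norm p (d k) \<le> 2" for k
    proof -
      show "d k \<in> lp_space p"
        unfolding d_def using p \<sigma> a by (intro lp_diff) auto
      have "lp_norm p (\<lambda>i. - a i) = lp_norm p a" "(\<lambda>i. - a i) \<in> lp_space p"
        using a by (auto simp: lp_norm_def lp_space_def)
      then show "lp_norm p (d k) \<le> 2"
        using lp_add(2)[of p "\<sigma> (r k)" "\<lambda>i. - a i"] p \<sigma>(1,2)[of "r k"] a by (simp add: d_def)
    qed
    have dlim: "(\<lambda>k. d k i) \<longlonglongrightarrow> 0" for i
      using tendsto_diff[OF lim[of i] tendsto_const[of "a i"]] by (simp add: d_def)
    have "(\<lambda>k. lp_norm p (kernel_op K (d k))) \<longlonglongrightarrow> 0"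
    proof (rule tendstoI)
      fix e :: real assume e: "e > 0"
      \<comment> \<open>The differences \<open>d k\<close> have norm at most 2, so the bound
        \<open>e / 4\<close> leaves \<open>e / 2\<close> for the finite block
        \<open>F\<close>.\<close>
      then obtain N where N: "kernel_bound p (\<lambda>i j. if max i j < N then 0 else K i j) (e / 4)"
        using tails[of "e / 4"] by auto
      let ?R = "\<lambda>i j. if max i j < N then 0 else K i j"
      define F where "F k i = (if i < N then \<Sum>j<N. of_real (K i j) * d k j else 0)" for k i
      have Fsum: "(\<Sum>i. norm (F k i) powr p) = (\<Sum>i<N. norm (\<Sum>j<N. of_real (K i j) * d k j) powr p)" for k
      proof -
        have "(\<Sum>i. norm (F k i) powr p) = (\<Sum>i<N. norm (F k i) powr p)"
          by (rule suminf_finite) (auto simp: F_def)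
        then show ?thesis
          by (simp add: F_def)
      qed
      have Flp: "F k \<in> lp_space p" for k
        unfolding lp_space_def mem_Collect_eq
        by (rule summable_finite[of "{..<N}"]) (auto simp: F_def)
      have split: "kernel_op K (d k) = (\<lambda>i. kernel_op ?R (d k) i + F k i)" for k
      proof
        fix i
        have 1: "(\<lambda>j. of_real (?R i j) * d k j) sums kernel_op ?R (d k) i"
          unfolding kernel_op_def using kernel_boundD(1)[OF N d(1)[of k], of i] by (rule summable_sums)
        have "(\<lambda>j. if j \<in> {..<N} then (if i < N then of_real (K i j) * d k j else 0) else 0) sums
            (\<Sum>j<N. if i < N then of_real (K i j) * d k j else 0)"
          by (rule sums_If_finite_set) simp
        also have "(\<Sum>j<N. if i < N then of_real (K i j) * d k j else 0) = F k i"
          by (simp add: F_def)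
        finally have "(\<lambda>j. of_real (?R i j) * d k j +
            (if j \<in> {..<N} then (if i < N then of_real (K i j) * d k j else 0) else 0)) sums
            (kernel_op ?R (d k) i + F k i)"
          by (rule sums_add[OF 1])
        also have "(\<lambda>j. of_real (?R i j) * d k j +
            (if j \<in> {..<N} then (if i < N then of_real (K i j) * d k j else 0) else 0))
            = (\<lambda>j. of_real (K i j) * d k j)"
          by auto
        finally show "kernel_op K (d k) i = kernel_op ?R (d k) i + F k i"
          unfolding kernel_op_def by (rule sums_unique[symmetric])
      qed
      have "(\<lambda>k. (\<Sum>i<N. norm (\<Sum>j<N. of_real (K i j) * d k j) powr p) powr (1 / p))
          \<longlonglongrightarrow> (\<Sum>i<N. norm (\<Sum>j<N. of_real (K i j) * (0 :: complex)) powr p) powr (1 / p)"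
        using p by (intro tendsto_powr' tendsto_intros dlim) (auto intro!: always_eventually sum_nonneg)
      then have "(\<lambda>k. lp_norm p (F k)) \<longlonglongrightarrow> 0"
        unfolding lp_norm_def Fsum by simp
      then have "eventually (\<lambda>k. lp_norm p (F k) < e / 2) sequentially"
        using e by (intro order_tendstoD(2)) auto
      then show "eventually (\<lambda>k. dist (lp_norm p (kernel_op K (d k))) 0 < e) sequentially"
      proof eventually_elim
        case (elim k)
        have "lp_norm p (kernel_op K (d k)) \<le> lp_norm p (kernel_op ?R (d k)) + lp_norm p (F k)"
          unfolding split using p by (intro lp_add(2) kernel_boundD(2)[OF N d(1)] Flp) auto
        moreover have "lp_norm p (kernel_op ?R (d k)) \<le> e / 4 * lp_norm p (d k)"
          by (rule kernel_boundD(3)[OF N d(1)])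
        moreover have "e / 4 * lp_norm p (d k) \<le> e / 4 * 2"
          using d(2) e by (intro mult_left_mono) auto
        ultimately show ?case
          using elim lp_norm_nonneg[of p "kernel_op K (d k)"] by simp
      qed
    qed
    then have "limitin mtopology (\<tau> \<circ> r) (kernel_op K a) sequentially"
      unfolding limitin_metric_dist_null
      using kernel_boundD(2)[OF K] a \<sigma>
      by (auto simp: lp_dist_def d_def kernel_op_diff[OF K \<sigma>(1) a(1)] \<sigma>(3))
    then show "\<exists>l r. l \<in> kernel_op K ` ?B \<and> strict_mono r \<and> limitin mtopology (\<tau> \<circ> r) l sequentially"
      using a r by blast
  qed
  \<comment> \<open>The image of the closed ball is itself compact, hence closed in a Hausdorff
    space.\<close>
  moreover from this have "mtopology closure_of (kernel_op K ` ?B) = kernel_op K ` ?B"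
    by (intro closure_of_closedin compactin_imp_closedin Hausdorff_space_mtopology)
  ultimately show ?thesis
    using bounded_linear_on_lp_kernel_op[OF K] by (simp add: compact_on_lp_def)
qed

text \<open>A finite net of radius \<open>e / 2\<close> exists, its finitely many members have small
  tails from a common index on, and Minkowski's inequality carries this over to all of
  \<open>S\<close>.\<close>

lemma compactin_lp_uniform_tails:
  assumes p: "p > 1" and S: "compactin (lp_topology p) S" and e: "e > 0"
  obtains N where "\<And>y m n. y \<in> S \<Longrightarrow> m \<ge> N \<Longrightarrow> (\<Sum>i\<in>{m..<n}. norm (y i) powr p) < e powr p"
proof -
  interpret Metric_space "lp_space p" "lp_dist p"
    using p by (intro Metric_space_lp) auto
  \<comment> \<open>Truncation to a finite index set turns a partial sum into an
    \<open>lp_norm\<close>, so that \<open>lp_add\<close> provides the triangle inequality for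
    it.\<close>
  let ?\<rho> = "\<lambda>I y i. if i \<in> I then y i else (0 :: complex)"
  have \<rho>: "?\<rho> I y \<in> lp_space p" "lp_norm p (?\<rho> I y) = (\<Sum>i\<in>I. norm (y i) powr p) powr (1 / p)"
    if "finite I" for I y
  proof -
    have "(\<Sum>i. norm (?\<rho> I y i) powr p) = (\<Sum>i\<in>I. norm (?\<rho> I y i) powr p)"
      by (rule suminf_finite[OF that]) auto
    also have "\<dots> = (\<Sum>i\<in>I. norm (y i) powr p)"
      by (rule sum.cong) auto
    finally show "lp_norm p (?\<rho> I y) = (\<Sum>i\<in>I. norm (y i) powr p) powr (1 / p)"
      by (simp add: lp_norm_def)
    show "?\<rho> I y \<in> lp_space p"
      unfolding lp_space_def mem_Collect_eq by (rule summable_finite[OF that]) auto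
  qed
  have "mtotally_bounded S"
    using S by (rule compactin_imp_mtotally_bounded)
  then obtain X where X: "finite X" "X \<subseteq> S" "S \<subseteq> (\<Union>x\<in>X. mball x (e / 2))"
    using e unfolding mtotally_bounded_def by (meson half_gt_zero)
  have "\<exists>N. \<forall>m\<ge>N. \<forall>n. (\<Sum>i\<in>{m..<n}. norm (x i) powr p) < (e / 2) powr p" if "x \<in> X" for x
  proof -
    have "x \<in> lp_space p"
      using that X(2) compactin_subset_topspace[OF S] by auto
    then have "summable (\<lambda>i. norm (x i) powr p)"
      by (simp add: lp_space_def)
    moreover have "(e / 2) powr p > 0"
      using e by simp
    ultimately obtain N where "\<forall>m\<ge>N. \<forall>n. norm (\<Sum>i\<in>{m..<n}. norm (x i) powr p) < (e / 2) powr p"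
      unfolding summable_Cauchy by blast
    then show ?thesis
      by (auto intro!: exI[of _ N] intro: le_less_trans[OF abs_ge_self])
  qed
  then obtain N where N: "\<And>x m n. x \<in> X \<Longrightarrow> m \<ge> N x \<Longrightarrow> (\<Sum>i\<in>{m..<n}. norm (x i) powr p) < (e / 2) powr p"
    by metis
  define N0 where "N0 = Max (insert 0 (N ` X))"
  have N0: "N x \<le> N0" if "x \<in> X" for x
    using that X by (auto simp: N0_def)
  show thesis
  proof (rule that[of N0])
    fix y m n assume y: "y \<in> S" and m: "m \<ge> N0"
    let ?I = "{m..<n}"
    obtain x where x: "x \<in> X" "lp_dist p x y < e / 2" and lp: "x \<in> lp_space p" "y \<in> lp_space p"
      using X y by auto
    have dist: "(\<lambda>i. y i - x i) \<in> lp_space p" "lp_norm p (\<lambda>i. y i - x i) < e / 2"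
      using x lp p commute[of x y] by (auto simp: lp_dist_def intro!: lp_diff)
    have "(\<Sum>i\<in>?I. norm (y i - x i) powr p) powr (1 / p)
        \<le> (lp_norm p (\<lambda>i. y i - x i) powr p) powr (1 / p)"
      using p dist by (intro powr_mono2 sum_le_lp_norm_powr sum_nonneg) auto
    then have 1: "lp_norm p (?\<rho> ?I (\<lambda>i. y i - x i)) < e / 2"
      using dist p \<rho>(2)[of ?I "\<lambda>i. y i - x i"] by (simp add: powr_powr lp_norm_nonneg)
    have "(\<Sum>i\<in>?I. norm (x i) powr p) < (e / 2) powr p"
      using m N0[OF x(1)] by (intro N x) auto
    then have "(\<Sum>i\<in>?I. norm (x i) powr p) powr (1 / p) < ((e / 2) powr p) powr (1 / p)"
      using p by (intro powr_less_mono2 sum_nonneg) auto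
    then have 2: "lp_norm p (?\<rho> ?I x) < e / 2"
      using e p \<rho>(2)[of ?I x] by (simp add: powr_powr)
    have "?\<rho> ?I y = (\<lambda>i. ?\<rho> ?I (\<lambda>i. y i - x i) i + ?\<rho> ?I x i)"
      by auto
    then have "lp_norm p (?\<rho> ?I y) \<le> lp_norm p (?\<rho> ?I (\<lambda>i. y i - x i)) + lp_norm p (?\<rho> ?I x)"
      using lp_add(2)[of p "?\<rho> ?I (\<lambda>i. y i - x i)" "?\<rho> ?I x"] p \<rho>(1)[of ?I] by simp
    then have "lp_norm p (?\<rho> ?I y) < e"
      using 1 2 by linarith
    then have "lp_norm p (?\<rho> ?I y) powr p < e powr p"
      using p by (intro powr_less_mono2 lp_norm_nonneg) auto
    then show "(\<Sum>i\<in>?I. norm (y i) powr p) < e powr p"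
      using p \<rho>(2)[of ?I y] by (simp add: powr_powr sum_nonneg)
  qed
qed

text \<open>On the block [a, 2a] a power is smallest at an end: at \<open>a\<close> for nonnegative
  exponents and at \<open>2 * a\<close> for negative ones. The minimum covers both signs.\<close>

lemma powr_block_ge:
  fixes a x \<theta> :: real
  assumes "0 < a" "a \<le> x" "x \<le> 2 * a"
  shows "min 1 (2 powr \<theta>) * a powr \<theta> \<le> x powr \<theta>"
proof (cases "\<theta> \<ge> 0")
  case True
  have "min 1 (2 powr \<theta>) * a powr \<theta> \<le> 1 * a powr \<theta>"
    by (intro mult_right_mono) auto
  also have "\<dots> \<le> x powr \<theta>"
    using True assms by (simp add: powr_mono2)
  finally show ?thesis .
next
  case False
  have "min 1 (2 powr \<theta>) * a powr \<theta> \<le> 2 powr \<theta> * a powr \<theta>"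
    by (intro mult_right_mono) auto
  also have "\<dots> = (2 * a) powr \<theta>"
    by (simp add: powr_mult)
  also have "\<dots> \<le> x powr \<theta>"
    using False assms by (intro powr_mono2') auto
  finally show ?thesis .
qed

text \<open>For i, j in [N, 2N) the kernel is at least \<kappa> N^(\<alpha>-\<beta>)
  \<open>D (2 * N)\<close>. Applied to the normalised indicator of this block, the operator gives
  entries on the block whose p-th powers sum to at least (\<kappa> N^(1+\<alpha>-\<beta>)
  \<open>D (2 * N)\<close>)^p, and uniform tails of the compact image make this small.\<close>

lemma decay_of_compact_on_lp_kernel_op:
  fixes D :: "nat \<Rightarrow> real"
  assumes p: "p > 1" and D: "\<And>k. 0 \<le> D k" "antimono D"
    and comp: "compact_on_lp p (kernel_op (\<lambda>i j. real (Suc i) powr \<alpha> * real (Suc j) powr (- \<beta>) * D (max i j)))"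
  shows "(\<lambda>N. real N powr (1 + \<alpha> - \<beta>) * D (2 * N)) \<longlonglongrightarrow> 0"
proof (rule tendstoI)
  fix e :: real assume e: "e > 0"
  interpret Metric_space "lp_space p" "lp_dist p"
    using p by (intro Metric_space_lp) auto
  define K where "K = (\<lambda>i j. real (Suc i) powr \<alpha> * real (Suc j) powr (- \<beta>) * D (max i j))"
  define \<kappa> where "\<kappa> = min 1 (2 powr \<alpha>) * min 1 (2 powr (- \<beta>))"
  have \<kappa>: "\<kappa> > 0"
    by (simp add: \<kappa>_def)
  let ?T = "kernel_op K ` {a \<in> lp_space p. lp_norm p a \<le> 1}"
  have "kernel_op K ` lp_space p \<subseteq> lp_space p" and cl: "compactin mtopology (mtopology closure_of ?T)"
    using comp unfolding K_def[symmetric] compact_on_lp_def bounded_linear_on_lp_def by auto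
  then have T: "?T \<subseteq> mtopology closure_of ?T"
    by (intro closure_of_subset) auto
  obtain N0 where N0: "\<And>y m n. y \<in> mtopology closure_of ?T \<Longrightarrow> m \<ge> N0 \<Longrightarrow>
      (\<Sum>i\<in>{m..<n}. norm (y i) powr p) < (\<kappa> * e) powr p"
    using compactin_lp_uniform_tails[OF p cl, of "\<kappa> * e"] \<kappa> e by auto
  have "real N powr (1 + \<alpha> - \<beta>) * D (2 * N) < e" if N: "N \<ge> N0" "N \<ge> 1" for N
  proof -
    let ?I = "{N..<2 * N}"
    define b where "b j = complex_of_real (if j \<in> ?I then real N powr (- (1 / p)) else 0)" for j
    have b: "b \<in> lp_space p" "lp_norm p b \<le> 1"
    proof -
      have "(\<Sum>j<n. norm (b j) powr p) \<le> 1 powr p" for n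
      proof -
        have "(\<Sum>j<n. norm (b j) powr p) = (\<Sum>j\<in>{..<n} \<inter> ?I. norm (b j) powr p)"
          by (rule sum.mono_neutral_right) (auto simp: b_def)
        also have "\<dots> \<le> (\<Sum>j\<in>?I. norm (b j) powr p)"
          by (rule sum_mono2) auto
        also have "\<dots> = (\<Sum>j\<in>?I. 1 / real N)"
          unfolding b_def norm_of_real
          using p N by (intro sum.cong refl) (simp add: powr_powr powr_neg_one)
        finally show ?thesis
          using N by simp
      qed
      from lp_norm_le[OF p _ this] show "b \<in> lp_space p" "lp_norm p b \<le> 1"
        by auto
    qed
    have ge: "\<kappa> * real N powr (1 + \<alpha> - \<beta> - 1 / p) * D (2 * N) \<le> norm (kernel_op K b i)"
      if i: "i \<in> ?I" for i
    proof -
      have "kernel_op K b i = (\<Sum>j\<in>?I. of_real (K i j) * b j)"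
        unfolding kernel_op_def by (rule suminf_finite) (auto simp: b_def)
      also have "\<dots> = of_real (\<Sum>j\<in>?I. K i j * real N powr (- (1 / p)))"
        by (simp add: b_def)
      finally have nrm: "norm (kernel_op K b i) = \<bar>\<Sum>j\<in>?I. K i j * real N powr (- (1 / p))\<bar>"
        by (simp only: norm_of_real)
      \<comment> \<open>The factor \<open>real N powr 1\<close> is the number of indices in the
        block, so the product becomes a sum of equal terms.\<close>
      have "real N powr (1 + \<alpha> - \<beta> - 1 / p)
          = real N powr 1 * real N powr (\<alpha> - \<beta>) * real N powr (- (1 / p))"
        unfolding powr_add[symmetric] by (simp add: algebra_simps)
      then have "\<kappa> * real N powr (1 + \<alpha> - \<beta> - 1 / p) * D (2 * N)
          = (\<Sum>j\<in>?I. (\<kappa> * real N powr (\<alpha> - \<beta>) * D (2 * N)) * real N powr (- (1 / p)))"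
        by simp
      also have "\<dots> \<le> (\<Sum>j\<in>?I. K i j * real N powr (- (1 / p)))"
      proof (intro sum_mono mult_right_mono)
        fix j assume j: "j \<in> ?I"
        have "\<kappa> * real N powr (\<alpha> - \<beta>) * D (2 * N) =
            (min 1 (2 powr \<alpha>) * real N powr \<alpha>) * (min 1 (2 powr (- \<beta>)) * real N powr (- \<beta>)) * D (2 * N)"
          using N by (simp add: \<kappa>_def powr_diff powr_minus_divide)
        also have "\<dots> \<le> real (Suc i) powr \<alpha> * real (Suc j) powr (- \<beta>) * D (max i j)"
          using i j N D by (intro mult_mono powr_block_ge antimonoD[OF D(2)]) auto
        finally show "\<kappa> * real N powr (\<alpha> - \<beta>) * D (2 * N) \<le> K i j"
          by (simp add: K_def)
      qed simp
      finally show ?thesis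
        unfolding nrm by (rule order_trans[OF _ abs_ge_self])
    qed
    \<comment> \<open>Adding the same p-th power over the \<open>N\<close> rows of the block
      restores the missing factor N^(1/p).\<close>
    have "(\<kappa> * (real N powr (1 + \<alpha> - \<beta>) * D (2 * N))) powr p
        = (\<Sum>i\<in>?I. (\<kappa> * real N powr (1 + \<alpha> - \<beta> - 1 / p) * D (2 * N)) powr p)"
    proof -
      have "real N powr (1 + \<alpha> - \<beta>) = real N powr (1 + \<alpha> - \<beta> - 1 / p) * real N powr (1 / p)"
        unfolding powr_add[symmetric] by simp
      then have "(\<kappa> * (real N powr (1 + \<alpha> - \<beta>) * D (2 * N))) powr p
          = (\<kappa> * real N powr (1 + \<alpha> - \<beta> - 1 / p) * D (2 * N)) powr p * (real N powr (1 / p)) powr p"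
        unfolding powr_mult[symmetric] by (simp only: mult_ac)
      also have "(real N powr (1 / p)) powr p = real N"
        using p by (simp add: powr_powr)
      finally show ?thesis
        by (simp add: mult_ac)
    qed
    also have "\<dots> \<le> (\<Sum>i\<in>?I. norm (kernel_op K b i) powr p)"
      using p \<kappa> D by (intro sum_mono powr_mono2 ge mult_nonneg_nonneg) auto
    also have "\<dots> < (\<kappa> * e) powr p"
      using N b T by (intro N0) auto
    finally have less: "(\<kappa> * (real N powr (1 + \<alpha> - \<beta>) * D (2 * N))) powr p < (\<kappa> * e) powr p" .
    have "\<kappa> * (real N powr (1 + \<alpha> - \<beta>) * D (2 * N)) < \<kappa> * e"
    proof (rule ccontr)
      assume "\<not> ?thesis"
      then have "(\<kappa> * e) powr p \<le> (\<kappa> * (real N powr (1 + \<alpha> - \<beta>) * D (2 * N))) powr p"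
        using p \<kappa> e by (intro powr_mono2) auto
      then show False
        using less by simp
    qed
    then show ?thesis
      using \<kappa> by simp
  qed
  then show "eventually (\<lambda>N. dist (real N powr (1 + \<alpha> - \<beta>) * D (2 * N)) 0 < e) sequentially"
    using D(1) by (intro eventually_sequentiallyI[of "max N0 1"]) auto
qed

section \<open>The characterisation of compactness\<close>

lemma (in finite_borel_01) antimono_moment: "antimono moment"
  unfolding moment_def
  by (intro antimonoI integral_mono integrable_power power_decreasing) (auto simp: space_01)

text \<open>Wherever the scaled moment at index max(i, j) is at most \<open>c\<close>, the kernel is
  dominated by \<open>c\<close> times the model kernel. A convergent sequence is bounded, which
  gives the first claim; beyond a suitable \<open>N\<close> the constant \<open>c\<close> can be
  taken small, which gives the second.\<close>

lemma (in finite_borel_01) kernel_bound_moment: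
  fixes p \<alpha> \<beta> :: real
  assumes p: "p > 1" and \<alpha>: "- 1 / p < \<alpha>" "\<alpha> < 1 - 1 / p" and \<beta>: "- 1 / p < \<beta>" "\<beta> < 1 - 1 / p"
    and lim: "(\<lambda>k. real (Suc k) powr (1 + \<alpha> - \<beta>) * moment k) \<longlonglongrightarrow> 0"
  defines "K \<equiv> \<lambda>i j. real (Suc i) powr \<alpha> * real (Suc j) powr (- \<beta>) * moment (max i j)"
  shows "\<exists>C. kernel_bound p K C"
    and "e > 0 \<Longrightarrow> \<exists>N. kernel_bound p (\<lambda>i j. if max i j < N then 0 else K i j) e"
proof -
  let ?s = "1 + \<alpha> - \<beta>"
  have K: "0 \<le> K i j" for i j
    by (simp add: K_def moment_nonneg)
  have Kle: "K i j \<le> c * (real (Suc i) powr \<alpha> * real (Suc j) powr (- \<beta>) * real (Suc (max i j)) powr (- ?s))"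
    if "real (Suc (max i j)) powr ?s * moment (max i j) \<le> c" for i j c
  proof -
    have "moment (max i j) = real (Suc (max i j)) powr (- ?s) * (real (Suc (max i j)) powr ?s * moment (max i j))"
      unfolding mult.assoc[symmetric] powr_add[symmetric] by simp
    also have "\<dots> \<le> real (Suc (max i j)) powr (- ?s) * c"
      using that by (intro mult_left_mono) auto
    finally have "K i j \<le> real (Suc i) powr \<alpha> * real (Suc j) powr (- \<beta>) * (real (Suc (max i j)) powr (- ?s) * c)"
      unfolding K_def by (intro mult_left_mono) auto
    then show ?thesis
      by (simp add: mult_ac)
  qed
  obtain C where C: "C \<ge> 0" and bound: "\<And>K c. c \<ge> 0 \<Longrightarrow> (\<And>i j. 0 \<le> K i j) \<Longrightarrow>
      (\<And>i j. K i j \<le> c * (real (Suc i) powr \<alpha> * real (Suc j) powr (- \<beta>) *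
        real (Suc (max i j)) powr (- ?s))) \<Longrightarrow> kernel_bound p K (c * C)"
    using kernel_bound_homogeneous[OF p \<alpha> \<beta>] by blast
  have "Bseq (\<lambda>k. real (Suc k) powr ?s * moment k)"
    using lim by (intro convergent_imp_Bseq) (auto simp: convergent_def)
  then obtain B where B: "B > 0" "\<And>k. norm (real (Suc k) powr ?s * moment k) \<le> B"
    by (auto elim: BseqE)
  have "kernel_bound p K (B * C)"
    using B by (intro bound K Kle) (auto simp: abs_le_iff)
  then show "\<exists>C. kernel_bound p K C" ..
  assume e: "e > 0"
  \<comment> \<open>The added 1 keeps the denominator positive also for
    \<open>C = 0\<close>.\<close>
  define c where "c = e / (C + 1)"
  have c: "c > 0" "c * C \<le> e"
    using e C by (auto simp: c_def field_simps)
  have "eventually (\<lambda>k. real (Suc k) powr ?s * moment k < c) sequentially"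
    using lim c(1) by (rule order_tendstoD)
  then obtain N where N: "\<And>k. k \<ge> N \<Longrightarrow> real (Suc k) powr ?s * moment k < c"
    by (auto simp: eventually_sequentially)
  have kb: "kernel_bound p (\<lambda>i j. if max i j < N then 0 else K i j) (c * C)"
  proof (rule bound)
    fix i j
    show "(if max i j < N then 0 else K i j)
        \<le> c * (real (Suc i) powr \<alpha> * real (Suc j) powr (- \<beta>) * real (Suc (max i j)) powr (- ?s))"
    proof (cases "max i j < N")
      case True
      then show ?thesis
        using c by simp
    next
      case False
      then have "max i j \<ge> N"
        by (simp only: not_less)
      from Kle[OF less_imp_le[OF N[OF this]]] show ?thesis
        by (simp only: False if_False)
    qed
  qed (use c K in auto)
  have "kernel_bound p (\<lambda>i j. if max i j < N then 0 else K i j) e"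
    unfolding kernel_bound_def
  proof (intro ballI conjI allI)
    fix a assume a: "a \<in> lp_space p"
    show "lp_norm p (kernel_op (\<lambda>i j. if max i j < N then 0 else K i j) a) \<le> e * lp_norm p a"
      using kernel_boundD(3)[OF kb a] mult_right_mono[OF c(2) lp_norm_nonneg[of p a]] by linarith
  qed (use kb in \<open>auto simp: kernel_bound_def\<close>)
  then show "\<exists>N. kernel_bound p (\<lambda>i j. if max i j < N then 0 else K i j) e" ..
qed

theorem theorem1p5:
  fixes p \<gamma> \<mu> \<nu> :: real and M :: "real measure"
  assumes "p > 1" and "\<gamma> > 0"
    and "-1 < \<mu>" and "\<mu> < p - 1"
    and "-1 < \<nu>" and "\<nu> < p - 1"
    and "borel_measure_01 M"
    and "finite_measure (weighted_measure \<gamma> M)"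
  shows "H_compact p \<mu> \<nu> \<gamma> M \<longleftrightarrow>
         vanishing_carleson (1 + (1 / p) * (\<mu> - \<nu>)) (weighted_measure \<gamma> M)"
proof -
  define R where "R = weighted_measure \<gamma> M"
  interpret finite_borel_01 R
    using assms by (simp add: R_def finite_borel_01_def finite_borel_01_axioms_def
        borel_measure_01_def weighted_measure_def)
  define \<alpha> where "\<alpha> = \<mu> / p"
  define \<beta> where "\<beta> = \<nu> / p"
  have p: "p > 1"
    by fact
  have \<alpha>: "- 1 / p < \<alpha>" "\<alpha> < 1 - 1 / p" and \<beta>: "- 1 / p < \<beta>" "\<beta> < 1 - 1 / p"
    using assms by (auto simp: \<alpha>_def \<beta>_def field_simps)
  have s: "1 + (1 / p) * (\<mu> - \<nu>) = 1 + \<alpha> - \<beta>"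
    by (simp add: \<alpha>_def \<beta>_def right_diff_distrib)
  have s_pos: "1 + \<alpha> - \<beta> > 0"
    using \<alpha> \<beta> by simp
  define K where "K = (\<lambda>i j. real (Suc i) powr \<alpha> * real (Suc j) powr (- \<beta>) * moment (max i j))"
  \<comment> \<open>The shift of both indices cancels the -1 in the exponent, and the weight is the
    density of \<rho> with respect to \<lambda>.\<close>
  have "I_moment \<gamma> M (Suc i) (Suc j) = moment (max i j)" for i j
  proof -
    have meas: "f \<in> borel_measurable M" if "f \<in> borel_measurable borel" for f :: "real \<Rightarrow> real"
      using measurable_restrict_space1[OF that, of "{0..<1}"] assms(7)
        measurable_cong_sets[of M "restrict_space borel {0..<1}" borel borel]
      by (auto simp: borel_measure_01_def)
    show ?thesis
      unfolding I_moment_def moment_def unfolding R_def weighted_measure_def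
      by (subst integral_density) (auto intro!: meas simp: mult.commute)
  qed
  then have H_term_eq: "H_term p \<mu> \<nu> \<gamma> M a i j = of_real (K i j) * a j" for a i j
    by (simp add: H_term_def H_coeff_def K_def \<alpha>_def \<beta>_def)
  then have H_op_eq: "H_op p \<mu> \<nu> \<gamma> M = kernel_op K"
    by (intro ext) (simp add: H_op_def kernel_op_def)
  show ?thesis
    unfolding s R_def[symmetric]
  proof
    assume "H_compact p \<mu> \<nu> \<gamma> M"
    then have "compact_on_lp p (kernel_op K)"
      by (simp add: H_compact_def H_op_eq)
    then show "vanishing_carleson (1 + \<alpha> - \<beta>) R"
      unfolding K_def
      by (intro vanishing_carleson_of_double_moment s_pos
          decay_of_compact_on_lp_kernel_op[OF p] moment_nonneg antimono_moment)
  next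
    assume "vanishing_carleson (1 + \<alpha> - \<beta>) R"
    then have lim: "(\<lambda>k. real (Suc k) powr (1 + \<alpha> - \<beta>) * moment k) \<longlonglongrightarrow> 0"
      by (intro moment_tendsto_0 s_pos) (simp add: vanishing_carleson_def)
    have tails: "\<exists>N. kernel_bound p (\<lambda>i j. if max i j < N then 0 else K i j) e" if "e > 0" for e
      unfolding K_def by (rule kernel_bound_moment(2)[OF p \<alpha> \<beta> lim that])
    obtain C where C: "kernel_bound p K C"
      using kernel_bound_moment(1)[OF p \<alpha> \<beta> lim, folded K_def] by blast
    have "compact_on_lp p (kernel_op K)"
      by (rule compact_on_lp_kernel_op[OF p C tails])
    moreover have "\<forall>a\<in>lp_space p. \<forall>i. summable (\<lambda>j. of_real (K i j) * a j)"
      using kernel_boundD(1)[OF C] by blast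
    moreover have "H_term p \<mu> \<nu> \<gamma> M a i = (\<lambda>j. of_real (K i j) * a j)" for a i
      using H_term_eq by (intro ext)
    ultimately show "H_compact p \<mu> \<nu> \<gamma> M"
      by (simp add: H_compact_def H_op_eq)
  qed
qed

end
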